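(* Let $\mathbf C$ be a category with an initial object and all $\omega$-colimits, let $I$ be an object of $\mathbf C$, let $\mathbf C_a = \mathbf C/I$ be the slice category and $U : \mathbf C_a \to \mathbf C$ the forgetful functor. Let $n$ be a natural number, and let $H : \mathbf C_a^{n+1} \to \mathbf C_a$ and $T : \mathbf C^{n+1} \to \mathbf C$ be $\omega$-cocontinuous functors such that $$T \circ U^{\times (n+1)} = U \circ H : \mathbf C_a^{n+1} \to \mathbf C .$$ Let $(T^\dagger, \phi)$ and $(H^\dagger, \psi)$ be their parameterised initial algebras (with $T$ regarded as a functor $\mathbf C^n \times \mathbf C \to \mathbf C$ and $H$ as a functor $\mathbf C_a^n \times \mathbf C_a \to \mathbf C_a$). Then: 1. $T^\dagger \circ U^{\times n} = U \circ H^\dagger : \mathbf C_a^n \to \mathbf C$. 2. $\phi\, U^{\times n} = U \psi$ as natural transformations $$T \circ \langle \mathrm{Id}, T^\dagger\rangle \circ U^{\times n} = U \circ H \circ \langle \mathrm{Id}, H^\dagger \rangle \Rightarrow T^\dagger \circ U^{\times n} = U \circ H^\dagger,$$ i.e. $\phi_{U^{\times n}(A)} = U(\psi_A)$ for every object $A$ of $\mathbf C_a^n$.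
   Context: Slice category. Objects of $\mathbf C_a = \mathbf C/I$ are pairs $(A, \diamond_A)$ with $A$ an object of $\mathbf C$ and $\diamond_A : A \to I$ a morphism of $\mathbf C$; a morphism $f:(A,\diamond_A) \to (B,\diamond_B)$ is a morphism $f : A \to B$ of $\mathbf C$ with $\diamond_B \circ f = \diamond_A$; composition and identities are as in $\mathbf C$. The forgetful functor is $U(A,\diamond_A) = A$, $U(f)=f$. $U^{\times n} : \mathbf C_a^n \to \mathbf C^n$ is the $n$-fold product of $U$. An $\omega$-colimit is a colimit of a diagram indexed by $\omega$; a functor is $\omega$-cocontinuous if it preserves all $\omega$-colimits. Under the stated assumptions on $\mathbf C$, the category $\mathbf C_a$ also has an initial object and all $\omega$-colimits. Parameterised initial algebras. For a functor $T : \mathbf A \times \mathbf B \to \mathbf B$, a parameterised initial algebra is a pair $(T^\dagger, \tau)$ with $T^\dagger : \mathbf A \to \mathbf B$ a functor and $\tau : T \circ \langle \mathrm{Id}, T^\dagger\rangle \Rightarrow T^\dagger$ a natural isomorphism such that for every object $A$ of $\mathbf A$, $(T^\dagger A, \tau_A)$ is an initial $T(A,-)$-algebra. If $\mathbf B$ has an initial object and all $\omega$-colimits and $T$ is $\omega$-cocontinuous, then $T$ has a parameterised initial algebra, and $T^\dagger$ is again $\omega$-cocontinuous.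
   Formalization: Strict equality fails for arbitrary independent parameterised initial algebras; proved for T†, H† built from chosen initial object and ω-colimits of C and the choice these induce on C/I, and, for every (T†,φ), for some (H†,ψ). *)

theory Defs
  imports Main
begin

section \<open>Categories, functors, natural isomorphisms\<close>

record ('o, 'm) cat =
  Obj :: "'o set"
  Arr :: "'m set"
  Dom :: "'m \<Rightarrow> 'o"
  Cod :: "'m \<Rightarrow> 'o"
  Ident :: "'o \<Rightarrow> 'm"
  Comp :: "'m \<Rightarrow> 'm \<Rightarrow> 'm"  \<comment> \<open>\<open>Comp C g f\<close> is \<open>g\<close> after \<open>f\<close>\<close>

definition hom :: "('o, 'm) cat \<Rightarrow> 'o \<Rightarrow> 'o \<Rightarrow> 'm set" where
  "hom C X Y = {f \<in> Arr C. Dom C f = X \<and> Cod C f = Y}"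

definition category :: "('o, 'm) cat \<Rightarrow> bool" where
  "category C \<longleftrightarrow>
     (\<forall>f\<in>Arr C. Dom C f \<in> Obj C \<and> Cod C f \<in> Obj C) \<and>
     (\<forall>X\<in>Obj C. Ident C X \<in> hom C X X) \<and>
     (\<forall>f\<in>Arr C. \<forall>g\<in>Arr C. Cod C f = Dom C g \<longrightarrow> Comp C g f \<in> hom C (Dom C f) (Cod C g)) \<and>
     (\<forall>f\<in>Arr C. Comp C f (Ident C (Dom C f)) = f \<and> Comp C (Ident C (Cod C f)) f = f) \<and>
     (\<forall>f\<in>Arr C. \<forall>g\<in>Arr C. \<forall>h\<in>Arr C. Cod C f = Dom C g \<longrightarrow> Cod C g = Dom C h \<longrightarrow>
        Comp C h (Comp C g f) = Comp C (Comp C h g) f)"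

definition is_iso :: "('o, 'm) cat \<Rightarrow> 'm \<Rightarrow> bool" where
  "is_iso C f \<longleftrightarrow> f \<in> Arr C \<and>
     (\<exists>g\<in>hom C (Cod C f) (Dom C f).
        Comp C g f = Ident C (Dom C f) \<and> Comp C f g = Ident C (Cod C f))"

record ('o, 'm, 'p, 'q) functr =
  omap :: "'o \<Rightarrow> 'p"
  amap :: "'m \<Rightarrow> 'q"

definition is_functor ::
    "('o, 'm) cat \<Rightarrow> ('p, 'q) cat \<Rightarrow> ('o, 'm, 'p, 'q) functr \<Rightarrow> bool" where
  "is_functor A B F \<longleftrightarrow>
     (\<forall>X\<in>Obj A. omap F X \<in> Obj B) \<and>
     (\<forall>f\<in>Arr A. amap F f \<in> hom B (omap F (Dom A f)) (omap F (Cod A f))) \<and>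
     (\<forall>X\<in>Obj A. amap F (Ident A X) = Ident B (omap F X)) \<and>
     (\<forall>f\<in>Arr A. \<forall>g\<in>Arr A. Cod A f = Dom A g \<longrightarrow>
        amap F (Comp A g f) = Comp B (amap F g) (amap F f))"

text \<open>Strict equality of functors with domain \<open>A\<close>; values outside the carriers of \<open>A\<close>
  are irrelevant.\<close>

definition functor_eq ::
    "('o, 'm) cat \<Rightarrow> ('o, 'm, 'p, 'q) functr \<Rightarrow> ('o, 'm, 'p, 'q) functr \<Rightarrow> bool" where
  "functor_eq A F G \<longleftrightarrow>
     (\<forall>X\<in>Obj A. omap F X = omap G X) \<and> (\<forall>f\<in>Arr A. amap F f = amap G f)"

definition id_fun :: "('o, 'm, 'o, 'm) functr" where
  "id_fun = \<lparr>omap = (\<lambda>X. X), amap = (\<lambda>f. f)\<rparr>"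

definition comp_fun ::
    "('p, 'q, 'r, 's) functr \<Rightarrow> ('o, 'm, 'p, 'q) functr \<Rightarrow> ('o, 'm, 'r, 's) functr"
    (infixl "\<circ>\<^sub>F" 55) where
  "G \<circ>\<^sub>F F = \<lparr>omap = (\<lambda>X. omap G (omap F X)), amap = (\<lambda>f. amap G (amap F f))\<rparr>"

definition pair_fun ::
    "('o, 'm, 'p, 'q) functr \<Rightarrow> ('o, 'm, 'r, 's) functr \<Rightarrow> ('o, 'm, 'p \<times> 'r, 'q \<times> 's) functr" where
  "pair_fun F G = \<lparr>omap = (\<lambda>X. (omap F X, omap G X)), amap = (\<lambda>f. (amap F f, amap G f))\<rparr>"

definition natural_iso ::
    "('o, 'm) cat \<Rightarrow> ('p, 'q) cat \<Rightarrow> ('o, 'm, 'p, 'q) functr \<Rightarrow> ('o, 'm, 'p, 'q) functr \<Rightarrow>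
      ('o \<Rightarrow> 'q) \<Rightarrow> bool" where
  "natural_iso A B F G \<tau> \<longleftrightarrow>
     (\<forall>X\<in>Obj A. \<tau> X \<in> hom B (omap F X) (omap G X) \<and> is_iso B (\<tau> X)) \<and>
     (\<forall>f\<in>Arr A. Comp B (\<tau> (Cod A f)) (amap F f) = Comp B (amap G f) (\<tau> (Dom A f)))"


section \<open>Products, powers and slices\<close>

definition prod_cat :: "('o, 'm) cat \<Rightarrow> ('p, 'q) cat \<Rightarrow> ('o \<times> 'p, 'm \<times> 'q) cat" where
  "prod_cat A B = \<lparr>
     Obj = Obj A \<times> Obj B,
     Arr = Arr A \<times> Arr B,
     Dom = (\<lambda>(f, g). (Dom A f, Dom B g)),
     Cod = (\<lambda>(f, g). (Cod A f, Cod B g)),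
     Ident = (\<lambda>(X, Y). (Ident A X, Ident B Y)),
     Comp = (\<lambda>(f', g') (f, g). (Comp A f' f, Comp B g' g))\<rparr>"

text \<open>The power \<open>C\<^sup>n\<close>: objects and morphisms are lists of length \<open>n\<close>.\<close>

definition pow_cat :: "('o, 'm) cat \<Rightarrow> nat \<Rightarrow> ('o list, 'm list) cat" where
  "pow_cat C n = \<lparr>
     Obj = {Xs. length Xs = n \<and> set Xs \<subseteq> Obj C},
     Arr = {fs. length fs = n \<and> set fs \<subseteq> Arr C},
     Dom = map (Dom C),
     Cod = map (Cod C),
     Ident = map (Ident C),
     Comp = map2 (Comp C)\<rparr>"

text \<open>\<open>pow_fun F\<close> acts as the \<open>n\<close>-fold product of \<open>F\<close> on lists of length \<open>n\<close>, for every \<open>n\<close>.\<close>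

definition pow_fun ::
    "('o, 'm, 'p, 'q) functr \<Rightarrow> ('o list, 'm list, 'p list, 'q list) functr" where
  "pow_fun F = \<lparr>omap = map (omap F), amap = map (amap F)\<rparr>"

text \<open>The identification of \<open>C\<^sup>n \<times> C\<close> with \<open>C\<^sup>n\<^sup>+\<^sup>1\<close>, and a functor on \<open>C\<^sup>n\<^sup>+\<^sup>1\<close> regarded as a functor
  on \<open>C\<^sup>n \<times> C\<close> by precomposing with it.\<close>

definition snoc_fun :: "('o list \<times> 'o, 'm list \<times> 'm, 'o list, 'm list) functr" where
  "snoc_fun = \<lparr>omap = (\<lambda>(Xs, X). Xs @ [X]), amap = (\<lambda>(fs, f). fs @ [f])\<rparr>"

definition split_last ::
    "('o list, 'm list, 'p, 'q) functr \<Rightarrow> ('o list \<times> 'o, 'm list \<times> 'm, 'p, 'q) functr" where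
  "split_last T = T \<circ>\<^sub>F snoc_fun"

text \<open>A slice morphism carries its domain and codomain, since the underlying morphism of \<open>C\<close>
  does not determine the two structure maps.\<close>

definition slice ::
    "('o, 'm) cat \<Rightarrow> 'o \<Rightarrow> ('o \<times> 'm, ('o \<times> 'm) \<times> 'm \<times> ('o \<times> 'm)) cat" where
  "slice C I = \<lparr>
     Obj = {(A, a). A \<in> Obj C \<and> a \<in> hom C A I},
     Arr = {((A, a), f, (B, b)). A \<in> Obj C \<and> a \<in> hom C A I \<and> B \<in> Obj C \<and> b \<in> hom C B I \<and>
              f \<in> hom C A B \<and> Comp C b f = a},
     Dom = (\<lambda>(X, f, Y). X),
     Cod = (\<lambda>(X, f, Y). Y),
     Ident = (\<lambda>X. (X, Ident C (fst X), X)),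
     Comp = (\<lambda>(Y, g, Z) (X, f, Y'). (X, Comp C g f, Z))\<rparr>"

definition slice_forget ::
    "('o \<times> 'm, ('o \<times> 'm) \<times> 'm \<times> ('o \<times> 'm), 'o, 'm) functr" where
  "slice_forget = \<lparr>omap = (\<lambda>(A, a). A), amap = (\<lambda>(X, f, Y). f)\<rparr>"


section \<open>Initial objects and colimits\<close>

definition is_initial :: "('o, 'm) cat \<Rightarrow> 'o \<Rightarrow> bool" where
  "is_initial C Z \<longleftrightarrow> Z \<in> Obj C \<and> (\<forall>X\<in>Obj C. \<exists>!f. f \<in> hom C Z X)"

definition is_cocone ::
    "('j, 'k) cat \<Rightarrow> ('o, 'm) cat \<Rightarrow> ('j, 'k, 'o, 'm) functr \<Rightarrow> 'o \<Rightarrow> ('j \<Rightarrow> 'm) \<Rightarrow> bool" where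
  "is_cocone J C D X \<kappa> \<longleftrightarrow> X \<in> Obj C \<and>
     (\<forall>j\<in>Obj J. \<kappa> j \<in> hom C (omap D j) X) \<and>
     (\<forall>u\<in>Arr J. Comp C (\<kappa> (Cod J u)) (amap D u) = \<kappa> (Dom J u))"

definition is_colimit ::
    "('j, 'k) cat \<Rightarrow> ('o, 'm) cat \<Rightarrow> ('j, 'k, 'o, 'm) functr \<Rightarrow> 'o \<Rightarrow> ('j \<Rightarrow> 'm) \<Rightarrow> bool" where
  "is_colimit J C D X \<kappa> \<longleftrightarrow> is_cocone J C D X \<kappa> \<and>
     (\<forall>Y \<mu>. is_cocone J C D Y \<mu> \<longrightarrow>
        (\<exists>!h. h \<in> hom C X Y \<and> (\<forall>j\<in>Obj J. Comp C h (\<kappa> j) = \<mu> j)))"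

text \<open>The poset \<open>\<omega>\<close>: there is one morphism \<open>(i, j)\<close> from \<open>i\<close> to \<open>j\<close> whenever \<open>i \<le> j\<close>.\<close>

definition omega :: "(nat, nat \<times> nat) cat" where
  "omega = \<lparr>
     Obj = UNIV,
     Arr = {(i, j). i \<le> j},
     Dom = fst,
     Cod = snd,
     Ident = (\<lambda>i. (i, i)),
     Comp = (\<lambda>(j', k) (i, j). (i, k))\<rparr>"

type_synonym ('o, 'm) chain = "(nat, nat \<times> nat, 'o, 'm) functr"

definition has_initial :: "('o, 'm) cat \<Rightarrow> bool" where
  "has_initial C \<longleftrightarrow> (\<exists>Z. is_initial C Z)"

definition has_omega_colimits :: "('o, 'm) cat \<Rightarrow> bool" where
  "has_omega_colimits C \<longleftrightarrow> (\<forall>D. is_functor omega C D \<longrightarrow> (\<exists>X \<kappa>. is_colimit omega C D X \<kappa>))"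

definition omega_cocontinuous ::
    "('o, 'm) cat \<Rightarrow> ('p, 'q) cat \<Rightarrow> ('o, 'm, 'p, 'q) functr \<Rightarrow> bool" where
  "omega_cocontinuous A B F \<longleftrightarrow> is_functor A B F \<and>
     (\<forall>D X \<kappa>. is_functor omega A D \<longrightarrow> is_colimit omega A D X \<kappa> \<longrightarrow>
        is_colimit omega B (F \<circ>\<^sub>F D) (omap F X) (\<lambda>i. amap F (\<kappa> i)))"


section \<open>Parameterised initial algebras\<close>

definition is_algebra ::
    "('o, 'm) cat \<Rightarrow> ('o, 'm, 'o, 'm) functr \<Rightarrow> 'o \<Rightarrow> 'm \<Rightarrow> bool" where
  "is_algebra B F X a \<longleftrightarrow> X \<in> Obj B \<and> a \<in> hom B (omap F X) X"

definition is_initial_algebra ::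
    "('o, 'm) cat \<Rightarrow> ('o, 'm, 'o, 'm) functr \<Rightarrow> 'o \<Rightarrow> 'm \<Rightarrow> bool" where
  "is_initial_algebra B F X a \<longleftrightarrow> is_algebra B F X a \<and>
     (\<forall>Y b. is_algebra B F Y b \<longrightarrow>
        (\<exists>!h. h \<in> hom B X Y \<and> Comp B h a = Comp B b (amap F h)))"

definition fix_param ::
    "('a, 'b) cat \<Rightarrow> ('a \<times> 'o, 'b \<times> 'm, 'p, 'q) functr \<Rightarrow> 'a \<Rightarrow> ('o, 'm, 'p, 'q) functr" where
  "fix_param A T X = \<lparr>omap = (\<lambda>Y. omap T (X, Y)), amap = (\<lambda>g. amap T (Ident A X, g))\<rparr>"

definition param_initial_algebra ::
    "('a, 'b) cat \<Rightarrow> ('o, 'm) cat \<Rightarrow> ('a \<times> 'o, 'b \<times> 'm, 'o, 'm) functr \<Rightarrow>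
      ('a, 'b, 'o, 'm) functr \<Rightarrow> ('a \<Rightarrow> 'm) \<Rightarrow> bool" where
  "param_initial_algebra A B T Td \<tau> \<longleftrightarrow>
     is_functor A B Td \<and>
     natural_iso A B (T \<circ>\<^sub>F pair_fun id_fun Td) Td \<tau> \<and>
     (\<forall>X\<in>Obj A. is_initial_algebra B (fix_param A T X) (omap Td X) (\<tau> X))"


section \<open>The construction from chosen colimits\<close>

text \<open>A parameterised initial algebra is determined only up to isomorphism. It becomes a definite
  functor, as is needed for strict equations, once an initial object and a colimit of every
  \<open>\<omega>\<close>-chain are chosen.\<close>

record ('o, 'm) choice =
  ch_initial :: 'o
  ch_colim :: "('o, 'm) chain \<Rightarrow> 'o"
  ch_leg :: "('o, 'm) chain \<Rightarrow> nat \<Rightarrow> 'm"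

definition is_choice :: "('o, 'm) cat \<Rightarrow> ('o, 'm) choice \<Rightarrow> bool" where
  "is_choice C c \<longleftrightarrow> is_initial C (ch_initial c) \<and>
     (\<forall>D. is_functor omega C D \<longrightarrow> is_colimit omega C D (ch_colim c D) (ch_leg c D))"

text \<open>The choice in the slice that the forgetful functor preserves on the nose: an initial object
  and colimits are those of \<open>C\<close>, with the induced maps to \<open>I\<close> as structure maps.\<close>

definition slice_choice ::
    "('o, 'm) cat \<Rightarrow> 'o \<Rightarrow> ('o, 'm) choice \<Rightarrow>
      ('o \<times> 'm, ('o \<times> 'm) \<times> 'm \<times> ('o \<times> 'm)) choice" where
  "slice_choice C I c =
     (let colim = (\<lambda>D. let X = ch_colim c (slice_forget \<circ>\<^sub>F D); \<kappa> = ch_leg c (slice_forget \<circ>\<^sub>F D)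
                      in (X, THE d. d \<in> hom C X I \<and> (\<forall>i. Comp C d (\<kappa> i) = snd (omap D i))))
      in \<lparr>ch_initial = (ch_initial c, THE d. d \<in> hom C (ch_initial c) I),
          ch_colim = colim,
          ch_leg = (\<lambda>D i. (omap D i, ch_leg c (slice_forget \<circ>\<^sub>F D) i, colim D))\<rparr>)"

text \<open>The chain \<open>0 \<rightarrow> F 0 \<rightarrow> F (F 0) \<rightarrow> \<dots>\<close>; \<open>chain_arr\<close> composes its \<open>k\<close> steps starting at \<open>i\<close>.\<close>

definition init_obj :: "('o, 'm) choice \<Rightarrow> ('o, 'm, 'o, 'm) functr \<Rightarrow> nat \<Rightarrow> 'o" where
  "init_obj c F i = (omap F ^^ i) (ch_initial c)"

definition init_step ::
    "('o, 'm) cat \<Rightarrow> ('o, 'm) choice \<Rightarrow> ('o, 'm, 'o, 'm) functr \<Rightarrow> nat \<Rightarrow> 'm" where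
  "init_step B c F i = (amap F ^^ i) (THE f. f \<in> hom B (ch_initial c) (omap F (ch_initial c)))"

fun chain_arr ::
    "('o, 'm) cat \<Rightarrow> ('o, 'm) choice \<Rightarrow> ('o, 'm, 'o, 'm) functr \<Rightarrow> nat \<Rightarrow> nat \<Rightarrow> 'm" where
  "chain_arr B c F i 0 = Ident B (init_obj c F i)"
| "chain_arr B c F i (Suc k) = Comp B (init_step B c F (i + k)) (chain_arr B c F i k)"

definition init_chain ::
    "('o, 'm) cat \<Rightarrow> ('o, 'm) choice \<Rightarrow> ('o, 'm, 'o, 'm) functr \<Rightarrow> ('o, 'm) chain" where
  "init_chain B c F =
     \<lparr>omap = init_obj c F, amap = (\<lambda>(i, j). chain_arr B c F i (j - i))\<rparr>"

definition init_alg_obj ::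
    "('o, 'm) cat \<Rightarrow> ('o, 'm) choice \<Rightarrow> ('o, 'm, 'o, 'm) functr \<Rightarrow> 'o" where
  "init_alg_obj B c F = ch_colim c (init_chain B c F)"

definition init_alg_map ::
    "('o, 'm) cat \<Rightarrow> ('o, 'm) choice \<Rightarrow> ('o, 'm, 'o, 'm) functr \<Rightarrow> 'm" where
  "init_alg_map B c F =
     (let X = init_alg_obj B c F; \<kappa> = ch_leg c (init_chain B c F)
      in THE a. a \<in> hom B (omap F X) X \<and> (\<forall>i. Comp B a (amap F (\<kappa> i)) = \<kappa> (Suc i)))"

definition dagger_iso ::
    "('a, 'b) cat \<Rightarrow> ('o, 'm) cat \<Rightarrow> ('o, 'm) choice \<Rightarrow>
      ('a \<times> 'o, 'b \<times> 'm, 'o, 'm) functr \<Rightarrow> 'a \<Rightarrow> 'm" where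
  "dagger_iso A B c T X = init_alg_map B c (fix_param A T X)"

text \<open>On a morphism \<open>f : X \<rightarrow> Y\<close>, the only possible value is the morphism of
  \<open>T(X,-)\<close>-algebras from \<open>T\<^sup>\<dagger> X\<close> to \<open>T\<^sup>\<dagger> Y\<close>, the latter made a \<open>T(X,-)\<close>-algebra along \<open>f\<close>.\<close>

definition dagger ::
    "('a, 'b) cat \<Rightarrow> ('o, 'm) cat \<Rightarrow> ('o, 'm) choice \<Rightarrow>
      ('a \<times> 'o, 'b \<times> 'm, 'o, 'm) functr \<Rightarrow> ('a, 'b, 'o, 'm) functr" where
  "dagger A B c T =
     (let ob = (\<lambda>X. init_alg_obj B c (fix_param A T X)); \<tau> = dagger_iso A B c T
      in \<lparr>omap = ob,
          amap = (\<lambda>f. THE h. h \<in> hom B (ob (Dom A f)) (ob (Cod A f)) \<and>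
                    Comp B h (\<tau> (Dom A f)) = Comp B (\<tau> (Cod A f)) (amap T (f, h)))\<rparr>)"

end

theory Submission
  imports Defs
begin

text \<open>The initial object and colimits chosen in the slice lie over those chosen in \<open>C\<close>, so the chain \<open>0 \<rightarrow> H(A,0) \<rightarrow> \<dots>\<close> is mapped by \<open>U\<close> literally onto the chain
  \<open>0 \<rightarrow> T(UA,0) \<rightarrow> \<dots>\<close>. By Adamek's theorem the colimits of these chains are the initial algebras,
  which therefore agree on the nose; on morphisms \<open>T\<^sup>\<dagger>\<close> and \<open>U H\<^sup>\<dagger>\<close> agree because an
  algebra morphism out of an initial algebra is unique. An arbitrary \<open>T\<^sup>\<dagger>\<close> is isomorphic to the
  constructed one, and the maps to \<open>I\<close> are transported along this isomorphism.\<close>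

text \<open>Strictness is the obstacle: \<open>ch_colim c\<close> is an arbitrary function of the
  chain, so it is not enough that two chains agree on the objects and arrows of
  \<open>omega\<close>; they have to be equal as records. Once carriers and structure maps agree,
  colimits are no longer needed: functoriality, naturality and the comparison on morphisms all
  follow from uniqueness of algebra morphisms. For this reason \<open>dagger_of\<close> accepts any
  pointwise family of initial algebras, and the same lemmas serve both the pair computed from
  colimits and the lift of a given \<open>Td\<close>. Powers are kept out of the comparison, which
  is made for an arbitrary functor \<open>P\<close> between parameter categories;
  \<open>pow_fun slice_forget\<close> is substituted for it at the end. Lists matter only for the
  identification of a power with a product and for passing from cocontinuity in all variables
  jointly to cocontinuity in the last one.\<close>

section \<open>Elementary rules for categories and functors\<close>

lemma homD:
  assumes "f \<in> hom C X Y"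
  shows "f \<in> Arr C" "Dom C f = X" "Cod C f = Y"
  using assms by (auto simp: hom_def)

lemma arr_in_hom: "f \<in> Arr C \<Longrightarrow> f \<in> hom C (Dom C f) (Cod C f)"
  by (simp add: hom_def)

lemma hom_obj:
  assumes "category C" "f \<in> hom C X Y"
  shows "X \<in> Obj C" "Y \<in> Obj C"
  using assms by (auto simp: hom_def category_def)

lemma ident_in_hom: "category C \<Longrightarrow> X \<in> Obj C \<Longrightarrow> Ident C X \<in> hom C X X"
  by (simp add: category_def)

lemma comp_in_hom:
  "category C \<Longrightarrow> f \<in> hom C X Y \<Longrightarrow> g \<in> hom C Y Z \<Longrightarrow> Comp C g f \<in> hom C X Z"
  unfolding category_def by (metis homD)

lemma comp_assoc:
  assumes "category C" "f \<in> hom C X Y" "g \<in> hom C Y Z" "h \<in> hom C Z W"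
  shows "Comp C h (Comp C g f) = Comp C (Comp C h g) f"
  using assms homD[OF assms(2)] homD[OF assms(3)] homD[OF assms(4)]
  unfolding category_def by metis

lemma comp_ident:
  assumes "category C" "f \<in> hom C X Y"
  shows "Comp C f (Ident C X) = f" "Comp C (Ident C Y) f = f"
  using assms by (auto simp: hom_def category_def)

lemma functor_obj: "is_functor A B F \<Longrightarrow> X \<in> Obj A \<Longrightarrow> omap F X \<in> Obj B"
  by (simp add: is_functor_def)

lemma functor_hom:
  "is_functor A B F \<Longrightarrow> f \<in> hom A X Y \<Longrightarrow> amap F f \<in> hom B (omap F X) (omap F Y)"
  unfolding is_functor_def by (metis homD)

lemma functor_ident: "is_functor A B F \<Longrightarrow> X \<in> Obj A \<Longrightarrow> amap F (Ident A X) = Ident B (omap F X)"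
  by (simp add: is_functor_def)

lemma functor_comp:
  "is_functor A B F \<Longrightarrow> f \<in> hom A X Y \<Longrightarrow> g \<in> hom A Y Z \<Longrightarrow>
    amap F (Comp A g f) = Comp B (amap F g) (amap F f)"
  unfolding is_functor_def by (metis homD)

lemma functorI:
  assumes "category A"
    and "\<And>X. X \<in> Obj A \<Longrightarrow> omap F X \<in> Obj B"
    and "\<And>X Y f. f \<in> hom A X Y \<Longrightarrow> amap F f \<in> hom B (omap F X) (omap F Y)"
    and "\<And>X. X \<in> Obj A \<Longrightarrow> amap F (Ident A X) = Ident B (omap F X)"
    and "\<And>X Y Z f g. f \<in> hom A X Y \<Longrightarrow> g \<in> hom A Y Z \<Longrightarrow>
      amap F (Comp A g f) = Comp B (amap F g) (amap F f)"
  shows "is_functor A B F"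
  using assms unfolding is_functor_def by (metis arr_in_hom)

lemma comp_fun_simps [simp]:
  "omap (G \<circ>\<^sub>F F) X = omap G (omap F X)" "amap (G \<circ>\<^sub>F F) f = amap G (amap F f)"
  by (simp_all add: comp_fun_def)

lemma comp_fun_assoc: "H \<circ>\<^sub>F G \<circ>\<^sub>F F = H \<circ>\<^sub>F (G \<circ>\<^sub>F F)"
  by (simp add: comp_fun_def)

lemma is_functor_comp:
  "is_functor A B F \<Longrightarrow> is_functor B C G \<Longrightarrow> is_functor A C (G \<circ>\<^sub>F F)"
  unfolding is_functor_def by (auto simp: hom_def)

lemma omega_cocontinuous_comp:
  assumes "omega_cocontinuous A B F" "omega_cocontinuous B C G"
  shows "omega_cocontinuous A C (G \<circ>\<^sub>F F)"
  using assms unfolding omega_cocontinuous_def comp_fun_simps comp_fun_assoc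
  by (meson is_functor_comp)

section \<open>The poset omega, colimits of chains, and choices of them\<close>

lemma omega_simps [simp]:
  "Obj omega = UNIV" "Arr omega = {(i, j). i \<le> j}" "Dom omega = fst" "Cod omega = snd"
  "Ident omega i = (i, i)" "Comp omega v u = (fst u, snd v)"
  by (auto simp: omega_def split: prod.splits)

lemma category_omega: "category omega"
  by (auto simp: category_def hom_def)

lemma initialD:
  assumes "is_initial C Z"
  shows "Z \<in> Obj C" "X \<in> Obj C \<Longrightarrow> \<exists>!f. f \<in> hom C Z X"
    "f \<in> hom C Z X \<Longrightarrow> g \<in> hom C Z X \<Longrightarrow> category C \<Longrightarrow> f = g"
  using assms unfolding is_initial_def by (blast dest: hom_obj)+

lemma omega_cocone_iff:
  "is_cocone omega C D X \<kappa> \<longleftrightarrow> X \<in> Obj C \<and> (\<forall>i. \<kappa> i \<in> hom C (omap D i) X) \<and>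
     (\<forall>i j. i \<le> j \<longrightarrow> Comp C (\<kappa> j) (amap D (i, j)) = \<kappa> i)"
  by (auto simp: is_cocone_def)

lemma omega_colimitD:
  assumes "is_colimit omega C D X \<kappa>"
  shows "X \<in> Obj C" "\<kappa> i \<in> hom C (omap D i) X"
    "i \<le> j \<Longrightarrow> Comp C (\<kappa> j) (amap D (i, j)) = \<kappa> i"
    "is_cocone omega C D Y \<mu> \<Longrightarrow> \<exists>!h. h \<in> hom C X Y \<and> (\<forall>i. Comp C h (\<kappa> i) = \<mu> i)"
  using assms unfolding is_colimit_def omega_cocone_iff[of C D X \<kappa>] by auto

lemma cocone_postcomp:
  assumes "category C" "is_cocone omega C D X \<kappa>" "is_functor omega C D" "h \<in> hom C X Y"
  shows "is_cocone omega C D Y (\<lambda>i. Comp C h (\<kappa> i))"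
proof -
  have k: "\<kappa> i \<in> hom C (omap D i) X" for i using assms(2) by (auto simp: omega_cocone_iff)
  have d: "amap D (i, j) \<in> hom C (omap D i) (omap D j)" if "i \<le> j" for i j
    using functor_hom[OF assms(3), of "(i, j)" i j] that by (simp add: hom_def)
  show ?thesis
    unfolding omega_cocone_iff
    using assms hom_obj[OF assms(1,4)] comp_in_hom[OF assms(1) k assms(4)]
      comp_assoc[OF assms(1) d k assms(4)]
    by (auto simp: omega_cocone_iff)
qed

text \<open>Legs of a colimit are jointly epic: \<open>h\<close> and \<open>k\<close> both mediate
  the cocone of composites with \<open>h\<close>.\<close>

lemma colimit_hom_eqI:
  assumes "category C" "is_functor omega C D" "is_colimit omega C D X \<kappa>"
    and "h \<in> hom C X Y" "k \<in> hom C X Y" "\<And>i. Comp C h (\<kappa> i) = Comp C k (\<kappa> i)"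
  shows "h = k"
proof -
  have "is_cocone omega C D Y (\<lambda>i. Comp C h (\<kappa> i))"
    using assms by (intro cocone_postcomp) (auto simp: is_colimit_def)
  from omega_colimitD(4)[OF assms(3) this] show ?thesis
    using assms by metis
qed

lemma choiceD:
  assumes "is_choice C c"
  shows "is_initial C (ch_initial c)"
    "is_functor omega C D \<Longrightarrow> is_colimit omega C D (ch_colim c D) (ch_leg c D)"
  using assms by (auto simp: is_choice_def)

text \<open>Needed where an arbitrary \<open>Td\<close> is given and no choice comes with it. The
  axiom of choice selects a colimit for all chains at once.\<close>

lemma is_choice_exists:
  assumes "has_initial C" "has_omega_colimits C"
  shows "\<exists>c. is_choice C c"
proof -
  obtain Z where Z: "is_initial C Z" using assms(1) by (auto simp: has_initial_def)
  obtain X \<kappa> where "\<And>D. is_functor omega C D \<Longrightarrow> is_colimit omega C D (X D) (\<kappa> D)"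
    using assms(2) unfolding has_omega_colimits_def by metis
  then have "is_choice C \<lparr>ch_initial = Z, ch_colim = X, ch_leg = \<kappa>\<rparr>"
    using Z by (simp add: is_choice_def)
  then show ?thesis by blast
qed

section \<open>Initial algebras\<close>

lemma algebraI: "category B \<Longrightarrow> a \<in> hom B (omap F X) X \<Longrightarrow> is_algebra B F X a"
  by (auto simp: is_algebra_def dest: hom_obj)

lemma initial_algebraD:
  assumes "is_initial_algebra B F X a"
  shows "X \<in> Obj B" "a \<in> hom B (omap F X) X"
    "is_algebra B F Y b \<Longrightarrow> \<exists>!h. h \<in> hom B X Y \<and> Comp B h a = Comp B b (amap F h)"
  using assms by (auto simp: is_initial_algebra_def is_algebra_def)

lemma initial_algebra_hom_eqI:
  assumes "category B" "is_initial_algebra B F X a" "b \<in> hom B (omap F Y) Y"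
    and "h \<in> hom B X Y" "Comp B h a = Comp B b (amap F h)"
    and "k \<in> hom B X Y" "Comp B k a = Comp B b (amap F k)"
  shows "h = k"
  using initial_algebraD(3)[OF assms(2) algebraI[OF assms(1,3)]] assms by blast

text \<open>Since \<open>a\<close> is itself an algebra morphism from \<open>amap F a\<close> to
  \<open>a\<close>, composing it with the morphism \<open>h\<close> back gives an endomorphism of
  the initial algebra, hence the identity; applying \<open>F\<close> to this yields the other
  equation. It supplies the invertibility in \<open>natural_iso\<close>.\<close>

lemma lambek_initial_algebra_iso:
  assumes B: "category B" and F: "is_functor B B F" and ini: "is_initial_algebra B F X a"
  shows "is_iso B a"
proof -
  note a = initial_algebraD(2)[OF ini] and X = initial_algebraD(1)[OF ini]
  note Fa = functor_hom[OF F a]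
  obtain h where h: "h \<in> hom B X (omap F X)" "Comp B h a = Comp B (amap F a) (amap F h)"
    using initial_algebraD(3)[OF ini algebraI[OF B Fa]] by blast
  note Fh = functor_hom[OF F h(1)]
  have "Comp B (Comp B a h) a = Comp B a (Comp B (amap F a) (amap F h))"
    using comp_assoc[OF B a h(1) a] h(2) by simp
  then have ah: "Comp B a h = Ident B X"
    using initial_algebra_hom_eqI[OF B ini a comp_in_hom[OF B h(1) a] _ ident_in_hom[OF B X]]
      comp_ident[OF B a] functor_ident[OF F X] functor_comp[OF F h(1) a] by metis
  then have "Comp B h a = Ident B (omap F X)"
    using h(2) functor_comp[OF F h(1) a] functor_ident[OF F X] by metis
  with ah h(1) show ?thesis
    unfolding is_iso_def using homD[OF a] by auto
qed

text \<open>Conjugating by an isomorphism moves the algebra onto a carrier fixed in advance, as is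
  needed when the carrier has to lie over a given object.\<close>

lemma initial_algebra_transport:
  assumes B: "category B" and F: "is_functor B B F" and ini: "is_initial_algebra B F X a"
    and i: "i \<in> hom B X Y" and j: "j \<in> hom B Y X"
    and ij: "Comp B i j = Ident B Y" and ji: "Comp B j i = Ident B X"
  shows "is_initial_algebra B F Y (Comp B i (Comp B a (amap F j)))" (is "is_initial_algebra B F Y ?a")
proof -
  note a = initial_algebraD(2)[OF ini]
  note X = hom_obj(1)[OF B i] and Y = hom_obj(2)[OF B i]
  note Fi = functor_hom[OF F i] and Fj = functor_hom[OF F j]
  have FijY: "Comp B (amap F j) (amap F i) = Ident B (omap F X)"
    using functor_comp[OF F i j] functor_ident[OF F X] ji by simp
  have aj: "Comp B a (amap F j) \<in> hom B (omap F Y) X" by (rule comp_in_hom[OF B Fj a])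
  have a': "?a \<in> hom B (omap F Y) Y" by (rule comp_in_hom[OF B aj i])
  show ?thesis
    unfolding is_initial_algebra_def
  proof (intro conjI allI impI)
    show "is_algebra B F Y ?a" by (rule algebraI[OF B a'])
  next
    fix Z b
    assume alg: "is_algebra B F Z b"
    then have b: "b \<in> hom B (omap F Z) Z" by (simp add: is_algebra_def)
    obtain h where h: "h \<in> hom B X Z" "Comp B h a = Comp B b (amap F h)"
      using initial_algebraD(3)[OF ini alg] by blast
    note Fh = functor_hom[OF F h(1)]
    show "\<exists>!h. h \<in> hom B Y Z \<and> Comp B h ?a = Comp B b (amap F h)"
    proof (intro ex1I conjI)
      show hj: "Comp B h j \<in> hom B Y Z" by (rule comp_in_hom[OF B j h(1)])
      have "Comp B (Comp B h j) ?a = Comp B (Comp B (Comp B h j) i) (Comp B a (amap F j))"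
        by (rule comp_assoc[OF B aj i hj])
      also have "Comp B (Comp B h j) i = h"
        using comp_assoc[OF B i j h(1)] ji comp_ident[OF B h(1)] by simp
      also have "Comp B h (Comp B a (amap F j)) = Comp B b (Comp B (amap F h) (amap F j))"
        using comp_assoc[OF B Fj a h(1)] comp_assoc[OF B Fj Fh b] h(2) by simp
      finally show "Comp B (Comp B h j) ?a = Comp B b (amap F (Comp B h j))"
        using functor_comp[OF F j h(1)] by simp
    next
      fix k
      assume "k \<in> hom B Y Z \<and> Comp B k ?a = Comp B b (amap F k)"
      then have k: "k \<in> hom B Y Z" "Comp B k ?a = Comp B b (amap F k)" by auto
      note ki = comp_in_hom[OF B i k(1)] and Fk = functor_hom[OF F k(1)]
      \<comment> \<open>\<open>i\<close> is an algebra morphism into the conjugate, so composing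
        with it turns \<open>k\<close> into a morphism out of the original initial algebra, where
        uniqueness is available.\<close>
      have "Comp B i a = Comp B ?a (amap F i)"
        using comp_assoc[OF B Fi aj i] comp_assoc[OF B Fi Fj a] FijY comp_ident[OF B a] by simp
      then have "Comp B (Comp B k i) a = Comp B b (amap F (Comp B k i))"
        using comp_assoc[OF B a i k(1)] comp_assoc[OF B Fi a' k(1)] comp_assoc[OF B Fi Fk b] k(2)
          functor_comp[OF F i k(1)] by simp
      then have "Comp B k i = h"
        using initial_algebra_hom_eqI[OF B ini b ki _ h] by simp
      then show "k = Comp B h j"
        using comp_assoc[OF B j i k(1)] ij comp_ident[OF B k(1)] by simp
    qed
  qed
qed

lemma initial_algebra_unique_iso:
  assumes B: "category B" and F: "is_functor B B F"
    and X: "is_initial_algebra B F X a" and Y: "is_initial_algebra B F Y b"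
  obtains i j where "i \<in> hom B X Y" "j \<in> hom B Y X"
    "Comp B i j = Ident B Y" "Comp B j i = Ident B X" "Comp B i a = Comp B b (amap F i)"
proof -
  \<comment> \<open>Stated with fresh variables so that exchanging the two algebras gives the other
    inverse law.\<close>
  have inv: "Comp B j i = Ident B X"
    if X: "is_initial_algebra B F X a" and Y: "is_initial_algebra B F Y b"
      and i: "i \<in> hom B X Y" "Comp B i a = Comp B b (amap F i)"
      and j: "j \<in> hom B Y X" "Comp B j b = Comp B a (amap F j)" for X Y a b i j
  proof -
    note a = initial_algebraD(2)[OF X] and b = initial_algebraD(2)[OF Y]
    have "Comp B (Comp B j i) a = Comp B a (amap F (Comp B j i))"
      using comp_assoc[OF B a i(1) j(1)] comp_assoc[OF B functor_hom[OF F i(1)] b j(1)]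
        comp_assoc[OF B functor_hom[OF F i(1)] functor_hom[OF F j(1)] a]
        functor_comp[OF F i(1) j(1)] i(2) j(2) by simp
    then show ?thesis
      using initial_algebra_hom_eqI[OF B X a comp_in_hom[OF B i(1) j(1)] _
          ident_in_hom[OF B initial_algebraD(1)[OF X]]]
        comp_ident[OF B a] functor_ident[OF F initial_algebraD(1)[OF X]] by metis
  qed
  obtain i where i: "i \<in> hom B X Y" "Comp B i a = Comp B b (amap F i)"
    using initial_algebraD(3)[OF X algebraI[OF B initial_algebraD(2)[OF Y]]] by blast
  obtain j where j: "j \<in> hom B Y X" "Comp B j b = Comp B a (amap F j)"
    using initial_algebraD(3)[OF Y algebraI[OF B initial_algebraD(2)[OF X]]] by blast
  show thesis
    using that[OF i(1) j(1) inv[OF Y X j i] inv[OF X Y i j] i(2)] .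
qed

section \<open>The initial algebra of an \<open>\<omega>\<close>-cocontinuous functor\<close>

context
  fixes B :: "('o, 'm) cat" and c :: "('o, 'm) choice" and F :: "('o, 'm, 'o, 'm) functr"
  assumes B: "category B" and c: "is_choice B c" and F: "is_functor B B F"
begin

lemma init_obj_Suc: "init_obj c F (Suc i) = omap F (init_obj c F i)"
  by (simp add: init_obj_def)

lemma init_step_Suc: "init_step B c F (Suc i) = amap F (init_step B c F i)"
  by (simp add: init_step_def)

lemma init_obj_in: "init_obj c F i \<in> Obj B"
  by (induction i)
    (simp_all add: init_obj_Suc functor_obj[OF F] init_obj_def initialD(1)[OF choiceD(1)[OF c]])

lemma init_step_0: "init_step B c F 0 \<in> hom B (ch_initial c) (omap F (ch_initial c))"
  unfolding init_step_def funpow_0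
  by (rule theI') (metis initialD(1,2) choiceD(1)[OF c] functor_obj[OF F])

lemma init_step_in: "init_step B c F i \<in> hom B (init_obj c F i) (init_obj c F (Suc i))"
proof (induction i)
  case 0
  show ?case using init_step_0 by (simp add: init_obj_def)
next
  case (Suc i)
  then show ?case unfolding init_step_Suc init_obj_Suc[of "Suc i"] init_obj_Suc[of i]
    using functor_hom[OF F Suc] by (simp add: init_obj_Suc)
qed

lemma chain_arr_in: "chain_arr B c F i k \<in> hom B (init_obj c F i) (init_obj c F (i + k))"
proof (induction k)
  case 0
  show ?case by (simp add: ident_in_hom[OF B init_obj_in])
next
  case (Suc k)
  from comp_in_hom[OF B this init_step_in] show ?case by simp
qed

lemma chain_arr_add:
  "chain_arr B c F i (k + l) = Comp B (chain_arr B c F (i + k) l) (chain_arr B c F i k)"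
proof (induction l)
  case 0
  show ?case by (simp add: comp_ident[OF B chain_arr_in])
next
  case (Suc l)
  then show ?case
    using comp_assoc[OF B chain_arr_in[of i k] chain_arr_in[of "i + k" l] init_step_in]
    by (simp add: add.assoc)
qed

text \<open>Applying \<open>F\<close> to the chain drops its first object and shifts the rest by
  one. This is what makes the legs from index 1 on a cocone over the image of the chain.\<close>

lemma chain_arr_Suc: "chain_arr B c F (Suc i) k = amap F (chain_arr B c F i k)"
proof (induction k)
  case 0
  show ?case by (simp add: functor_ident[OF F init_obj_in] init_obj_Suc)
next
  case (Suc k)
  then show ?case
    using functor_comp[OF F chain_arr_in[of i k] init_step_in] by (simp add: init_step_Suc)
qed

lemma init_chain_simps [simp]:
  "omap (init_chain B c F) = init_obj c F"
  "amap (init_chain B c F) (i, j) = chain_arr B c F i (j - i)"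
  by (simp_all add: init_chain_def)

lemma init_chain_functor: "is_functor omega B (init_chain B c F)"
proof (rule functorI[OF category_omega])
  fix i j u
  assume "u \<in> hom omega i j"
  then have "u = (i, j)" "i \<le> j" by (auto simp: hom_def)
  then show "amap (init_chain B c F) u \<in> hom B (omap (init_chain B c F) i) (omap (init_chain B c F) j)"
    using chain_arr_in[of i "j - i"] by simp
next
  fix i j k u v
  assume "u \<in> hom omega i j" "v \<in> hom omega j k"
  then have uv: "u = (i, j)" "v = (j, k)" "i \<le> j" "j \<le> k" by (auto simp: hom_def)
  then show "amap (init_chain B c F) (Comp omega v u) =
      Comp B (amap (init_chain B c F) v) (amap (init_chain B c F) u)"
    using chain_arr_add[of i "j - i" "k - j"] by simp
qed (simp_all add: init_obj_in)

text \<open>All arrows of the chain are composites of single steps, so it suffices to check the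
  triangles there.\<close>

lemma init_chain_cocone:
  assumes m: "\<And>i. \<mu> i \<in> hom B (init_obj c F i) Y"
    and s: "\<And>i. Comp B (\<mu> (Suc i)) (init_step B c F i) = \<mu> i"
  shows "is_cocone omega B (init_chain B c F) Y \<mu>"
proof -
  have "Comp B (\<mu> (i + k)) (chain_arr B c F i k) = \<mu> i" for i k
  proof (induction k)
    case 0
    show ?case by (simp add: comp_ident[OF B m])
  next
    case (Suc k)
    then show ?case
      using comp_assoc[OF B chain_arr_in[of i k] init_step_in m] s by simp
  qed
  then have "Comp B (\<mu> j) (chain_arr B c F i (j - i)) = \<mu> i" if "i \<le> j" for i j
    using that le_add_diff_inverse by metis
  then show ?thesis
    using m hom_obj(2)[OF B m] by (simp add: omega_cocone_iff)
qed

context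
  assumes Fcc: "omega_cocontinuous B B F"
begin

lemma init_chain_colimit:
  "is_colimit omega B (init_chain B c F) (init_alg_obj B c F) (ch_leg c (init_chain B c F))"
  unfolding init_alg_obj_def by (rule choiceD(2)[OF c init_chain_functor])

text \<open>Here cocontinuity enters: maps out of \<open>F\<close> of the colimit can be defined and
  compared on the image legs.\<close>

lemma init_chain_colimit_image:
  "is_colimit omega B (F \<circ>\<^sub>F init_chain B c F) (omap F (init_alg_obj B c F))
     (\<lambda>i. amap F (ch_leg c (init_chain B c F) i))"
  using Fcc init_chain_functor init_chain_colimit by (auto simp: omega_cocontinuous_def)

text \<open>This justifies the definite description in \<open>init_alg_map\<close>; the map is the
  comparison from the colimit of the shifted chain to that of the chain.\<close>

lemma init_alg_map_ex1:
  "\<exists>!a. a \<in> hom B (omap F (init_alg_obj B c F)) (init_alg_obj B c F) \<and>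
     (\<forall>i. Comp B a (amap F (ch_leg c (init_chain B c F) i)) = ch_leg c (init_chain B c F) (Suc i))"
proof (rule omega_colimitD(4)[OF init_chain_colimit_image])
  note K = omega_colimitD[OF init_chain_colimit]
  have "Comp B (ch_leg c (init_chain B c F) (Suc j)) (chain_arr B c F (Suc i) (j - i)) =
      ch_leg c (init_chain B c F) (Suc i)" if "i \<le> j" for i j
    using K(3)[of "Suc i" "Suc j"] that by simp
  then show "is_cocone omega B (F \<circ>\<^sub>F init_chain B c F) (init_alg_obj B c F)
      (\<lambda>i. ch_leg c (init_chain B c F) (Suc i))"
    using K(1) K(2)[of "Suc _"] by (auto simp: omega_cocone_iff chain_arr_Suc init_obj_Suc)
qed

lemma init_alg_map:
  "init_alg_map B c F \<in> hom B (omap F (init_alg_obj B c F)) (init_alg_obj B c F)"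
  "Comp B (init_alg_map B c F) (amap F (ch_leg c (init_chain B c F) i)) =
     ch_leg c (init_chain B c F) (Suc i)"
  using theI'[OF init_alg_map_ex1] unfolding init_alg_map_def Let_def by auto

lemma adamek_init_alg_initial: "is_initial_algebra B F (init_alg_obj B c F) (init_alg_map B c F)"
  (is "is_initial_algebra B F ?X ?a")
  unfolding is_initial_algebra_def
proof (intro conjI allI impI)
  show "is_algebra B F ?X ?a" by (rule algebraI[OF B init_alg_map(1)])
next
  fix Y b
  assume "is_algebra B F Y b"
  then have Y: "Y \<in> Obj B" and b: "b \<in> hom B (omap F Y) Y" by (auto simp: is_algebra_def)
  let ?\<kappa> = "ch_leg c (init_chain B c F)"
  note Z = choiceD(1)[OF c]
  note K = omega_colimitD[OF init_chain_colimit]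
  have k: "?\<kappa> i \<in> hom B (init_obj c F i) ?X" for i using K(2)[of i] by simp
  obtain z where z: "z \<in> hom B (ch_initial c) Y" using initialD(2)[OF Z Y] by blast
  \<comment> \<open>The recursion is forced: if \<open>h\<close> is an algebra morphism, then h
    after leg i+1 equals h after \<open>a\<close> after F(leg i), that is \<open>b\<close> after F(h
    after leg i). The start \<open>z\<close> is forced by initiality. The same computation gives
    uniqueness below.\<close>
  define \<mu> where "\<mu> = rec_nat z (\<lambda>i m. Comp B b (amap F m))"
  have \<mu>0: "\<mu> 0 = z" and \<mu>S: "\<mu> (Suc i) = Comp B b (amap F (\<mu> i))" for i
    by (simp_all add: \<mu>_def)
  have m: "\<mu> i \<in> hom B (init_obj c F i) Y" for i
  proof (induction i)
    case 0
    then show ?case using z by (simp add: \<mu>0 init_obj_def)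
  next
    case (Suc i)
    then show ?case using comp_in_hom[OF B functor_hom[OF F Suc] b] by (simp add: \<mu>S init_obj_Suc)
  qed
  have s: "Comp B (\<mu> (Suc i)) (init_step B c F i) = \<mu> i" for i
  proof (induction i)
    case 0
    have "Comp B (\<mu> (Suc 0)) (init_step B c F 0) \<in> hom B (ch_initial c) Y"
      using comp_in_hom[OF B init_step_in[of 0] m[of "Suc 0"]] by (simp add: init_obj_def[of _ _ 0])
    then show ?case using initialD(3)[OF Z _ z B] \<mu>0 by simp
  next
    case (Suc i)
    note Fm = functor_hom[OF F m[of "Suc i"]] and Fs = functor_hom[OF F init_step_in[of i]]
    show ?case
      using comp_assoc[OF B Fs Fm b] functor_comp[OF F init_step_in m, of i] Suc
      by (simp add: \<mu>S[of "Suc i"] \<mu>S[of i] init_step_Suc)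
  qed
  obtain h where h: "h \<in> hom B ?X Y" "\<And>i. Comp B h (?\<kappa> i) = \<mu> i"
    using K(4)[OF init_chain_cocone[OF m s]] by blast
  note Fh = functor_hom[OF F h(1)] and a = init_alg_map(1)
  show "\<exists>!h. h \<in> hom B ?X Y \<and> Comp B h ?a = Comp B b (amap F h)"
  proof (intro ex1I conjI)
    show "h \<in> hom B ?X Y" by fact
    \<comment> \<open>Tested on the image legs, both sides restrict to
      \<open>\<mu> (Suc i)\<close>.\<close>
    show "Comp B h ?a = Comp B b (amap F h)"
    proof (rule colimit_hom_eqI[OF B is_functor_comp[OF init_chain_functor F] init_chain_colimit_image])
      show "Comp B h ?a \<in> hom B (omap F ?X) Y" by (rule comp_in_hom[OF B a h(1)])
      show "Comp B b (amap F h) \<in> hom B (omap F ?X) Y" by (rule comp_in_hom[OF B Fh b])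
      fix i
      note Fk = functor_hom[OF F k[of i]]
      show "Comp B (Comp B h ?a) (amap F (?\<kappa> i)) = Comp B (Comp B b (amap F h)) (amap F (?\<kappa> i))"
        using comp_assoc[OF B Fk a h(1)] comp_assoc[OF B Fk Fh b] functor_comp[OF F k h(1), of i]
          h(2) init_alg_map(2)[of i] \<mu>S[of i] by metis
    qed
  next
    fix g
    assume "g \<in> hom B ?X Y \<and> Comp B g ?a = Comp B b (amap F g)"
    then have g: "g \<in> hom B ?X Y" "Comp B g ?a = Comp B b (amap F g)" by auto
    note Fg = functor_hom[OF F g(1)]
    have "Comp B g (?\<kappa> i) = \<mu> i" for i
    proof (induction i)
      case 0
      have "Comp B g (?\<kappa> 0) \<in> hom B (ch_initial c) Y"
        using comp_in_hom[OF B k[of 0] g(1)] by (simp add: init_obj_def)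
      then show ?case using initialD(3)[OF Z _ z B] \<mu>0 by simp
    next
      case (Suc i)
      note Fk = functor_hom[OF F k[of i]]
      show ?case
        using comp_assoc[OF B Fk a g(1)] comp_assoc[OF B Fk Fg b] functor_comp[OF F k g(1), of i]
          Suc init_alg_map(2)[of i] \<mu>S[of i] g(2) by metis
    qed
    then show "g = h"
      using colimit_hom_eqI[OF B init_chain_functor init_chain_colimit g(1) h(1)] h(2) by simp
  qed
qed

end

end

section \<open>Parameterised initial algebras\<close>

lemma prod_cat_hom:
  "(f, g) \<in> hom (prod_cat A B) (X, Y) (X', Y') \<longleftrightarrow> f \<in> hom A X X' \<and> g \<in> hom B Y Y'"
  by (auto simp: hom_def prod_cat_def)

lemma prod_cat_simps [simp]:
  "(X, Y) \<in> Obj (prod_cat A B) \<longleftrightarrow> X \<in> Obj A \<and> Y \<in> Obj B"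
  "Ident (prod_cat A B) (X, Y) = (Ident A X, Ident B Y)"
  "Comp (prod_cat A B) (f', g') (f, g) = (Comp A f' f, Comp B g' g)"
  by (simp_all add: prod_cat_def)

lemma fix_param_simps [simp]:
  "omap (fix_param A T X) Y = omap T (X, Y)" "amap (fix_param A T X) g = amap T (Ident A X, g)"
  by (simp_all add: fix_param_def)

text \<open>The arrow part of \<open>dagger\<close>, freed from the colimit construction: carriers
  and structure maps may be any family of initial algebras, in particular one lying over a
  prescribed \<open>Td\<close>.\<close>

definition dagger_of ::
    "('a, 'b) cat \<Rightarrow> ('o, 'm) cat \<Rightarrow> ('a \<times> 'o, 'b \<times> 'm, 'o, 'm) functr \<Rightarrow>
      ('a \<Rightarrow> 'o) \<Rightarrow> ('a \<Rightarrow> 'm) \<Rightarrow> ('a, 'b, 'o, 'm) functr" where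
  "dagger_of A B T ob \<tau> =
     \<lparr>omap = ob,
      amap = (\<lambda>f. THE h. h \<in> hom B (ob (Dom A f)) (ob (Cod A f)) \<and>
                Comp B h (\<tau> (Dom A f)) = Comp B (\<tau> (Cod A f)) (amap T (f, h)))\<rparr>"

lemma dagger_eq_dagger_of:
  "dagger A B c T = dagger_of A B T (\<lambda>X. init_alg_obj B c (fix_param A T X)) (dagger_iso A B c T)"
  by (simp add: dagger_def dagger_of_def Let_def)

context
  fixes A :: "('a, 'b) cat" and B :: "('o, 'm) cat"
    and T :: "('a \<times> 'o, 'b \<times> 'm, 'o, 'm) functr"
  assumes A: "category A" and B: "category B" and T: "is_functor (prod_cat A B) B T"
begin

lemma bifunctor_hom:
  "f \<in> hom A X X' \<Longrightarrow> g \<in> hom B Y Y' \<Longrightarrow> amap T (f, g) \<in> hom B (omap T (X, Y)) (omap T (X', Y'))"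
  by (rule functor_hom[OF T]) (simp add: prod_cat_hom)

lemma bifunctor_comp:
  assumes "f \<in> hom A X X'" "g \<in> hom B Y Y'" "f' \<in> hom A X' X''" "g' \<in> hom B Y' Y''"
  shows "amap T (Comp A f' f, Comp B g' g) = Comp B (amap T (f', g')) (amap T (f, g))"
  using functor_comp[OF T, of "(f, g)" "(X, Y)" "(X', Y')" "(f', g')" "(X'', Y'')"] assms
  by (simp add: prod_cat_hom)

lemma bifunctor_ident:
  "X \<in> Obj A \<Longrightarrow> Y \<in> Obj B \<Longrightarrow> amap T (Ident A X, Ident B Y) = Ident B (omap T (X, Y))"
  using functor_ident[OF T, of "(X, Y)"] by simp

lemma fix_param_functor:
  assumes X: "X \<in> Obj A"
  shows "is_functor B B (fix_param A T X)"
proof (rule functorI[OF B])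
  fix Y
  assume "Y \<in> Obj B"
  then show "omap (fix_param A T X) Y \<in> Obj B" using functor_obj[OF T, of "(X, Y)"] X by simp
next
  fix Y Z W f g
  note iX = ident_in_hom[OF A X]
  assume f: "f \<in> hom B Y Z"
  then show "amap (fix_param A T X) f \<in> hom B (omap (fix_param A T X) Y) (omap (fix_param A T X) Z)"
    using bifunctor_hom[OF iX] by simp
  assume "g \<in> hom B Z W"
  then show "amap (fix_param A T X) (Comp B g f) =
      Comp B (amap (fix_param A T X) g) (amap (fix_param A T X) f)"
    using bifunctor_comp[OF iX f iX] comp_ident[OF A iX] by simp
qed (simp add: bifunctor_ident X)

context
  fixes ob :: "'a \<Rightarrow> 'o" and \<tau> :: "'a \<Rightarrow> 'm"
  assumes ini: "\<And>X. X \<in> Obj A \<Longrightarrow> is_initial_algebra B (fix_param A T X) (ob X) (\<tau> X)"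
begin

lemma struct_hom: "X \<in> Obj A \<Longrightarrow> \<tau> X \<in> hom B (omap T (X, ob X)) (ob X)"
  using initial_algebraD(2)[OF ini] by simp

text \<open>Restriction along \<open>f : X \<rightarrow> Y\<close> turns a \<open>T(Y,-)\<close>-algebra into a \<open>T(X,-)\<close>-algebra, and
  \<open>T(f,h) = T(f,1) \<circ> T(1,h)\<close>.\<close>
lemma param_map_ex1:
  assumes f: "f \<in> hom A X Y"
  shows "\<exists>!h. h \<in> hom B (ob X) (ob Y) \<and> Comp B h (\<tau> X) = Comp B (\<tau> Y) (amap T (f, h))"
proof -
  note X = hom_obj(1)[OF A f] and Y = hom_obj(2)[OF A f]
  note iX = ident_in_hom[OF A X]
  note obY = initial_algebraD(1)[OF ini[OF Y]]
  note i = ident_in_hom[OF B obY]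
  note Tf = bifunctor_hom[OF f i]
  have "is_algebra B (fix_param A T X) (ob Y) (Comp B (\<tau> Y) (amap T (f, Ident B (ob Y))))"
    using comp_in_hom[OF B Tf struct_hom[OF Y]] by (simp add: algebraI[OF B])
  from initial_algebraD(3)[OF ini[OF X] this]
  have "\<exists>!h. h \<in> hom B (ob X) (ob Y) \<and> Comp B h (\<tau> X) =
      Comp B (Comp B (\<tau> Y) (amap T (f, Ident B (ob Y)))) (amap T (Ident A X, h))"
    by simp
  moreover have "Comp B (Comp B (\<tau> Y) (amap T (f, Ident B (ob Y)))) (amap T (Ident A X, h)) =
      Comp B (\<tau> Y) (amap T (f, h))" if h: "h \<in> hom B (ob X) (ob Y)" for h
    using comp_assoc[OF B bifunctor_hom[OF iX h] Tf struct_hom[OF Y]] bifunctor_comp[OF iX h f i]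
      comp_ident[OF A f] comp_ident[OF B h] by simp
  ultimately show ?thesis by (metis (no_types, lifting))
qed

lemma dagger_of_map:
  assumes f: "f \<in> hom A X Y"
  shows "amap (dagger_of A B T ob \<tau>) f \<in> hom B (ob X) (ob Y)"
    "Comp B (amap (dagger_of A B T ob \<tau>) f) (\<tau> X) =
       Comp B (\<tau> Y) (amap T (f, amap (dagger_of A B T ob \<tau>) f))"
  using theI'[OF param_map_ex1[OF f]] homD[OF f] by (auto simp: dagger_of_def)

lemma dagger_of_map_eqI:
  assumes f: "f \<in> hom A X Y" and "h \<in> hom B (ob X) (ob Y)"
    and "Comp B h (\<tau> X) = Comp B (\<tau> Y) (amap T (f, h))"
  shows "amap (dagger_of A B T ob \<tau>) f = h"
  using param_map_ex1[OF f] dagger_of_map[OF f] assms by blast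

text \<open>Identities and pasted composites of the defining squares are again such squares, so both
  functor laws come from uniqueness in \<open>param_map_ex1\<close>.\<close>

lemma dagger_of_functor: "is_functor A B (dagger_of A B T ob \<tau>)" (is "is_functor A B ?D")
proof (rule functorI[OF A])
  have om: "omap ?D X = ob X" for X by (simp add: dagger_of_def)
  fix X
  assume X: "X \<in> Obj A"
  note obX = initial_algebraD(1)[OF ini[OF X]]
  show "omap ?D X \<in> Obj B" using obX om by simp
  show "amap ?D (Ident A X) = Ident B (omap ?D X)"
    using dagger_of_map_eqI[OF ident_in_hom[OF A X] ident_in_hom[OF B obX]]
      bifunctor_ident[OF X obX] comp_ident[OF B struct_hom[OF X]] om by simp
next
  have om: "omap ?D X = ob X" for X by (simp add: dagger_of_def)
  fix X Y Z f g
  assume f: "f \<in> hom A X Y"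
  show "amap ?D f \<in> hom B (omap ?D X) (omap ?D Y)" using dagger_of_map(1)[OF f] om by simp
  assume g: "g \<in> hom A Y Z"
  note X = hom_obj(1)[OF A f] and Y = hom_obj(1)[OF A g] and Z = hom_obj(2)[OF A g]
  note F = dagger_of_map[OF f] and G = dagger_of_map[OF g]
  note TF = bifunctor_hom[OF f F(1)] and TG = bifunctor_hom[OF g G(1)]
  show "amap ?D (Comp A g f) = Comp B (amap ?D g) (amap ?D f)"
  proof (rule dagger_of_map_eqI[OF comp_in_hom[OF A f g] comp_in_hom[OF B F(1) G(1)]])
    show "Comp B (Comp B (amap ?D g) (amap ?D f)) (\<tau> X) =
        Comp B (\<tau> Z) (amap T (Comp A g f, Comp B (amap ?D g) (amap ?D f)))"
      using comp_assoc[OF B struct_hom[OF X] F(1) G(1)] comp_assoc[OF B TF struct_hom[OF Y] G(1)]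
        comp_assoc[OF B TF TG struct_hom[OF Z]] bifunctor_comp[OF f F(1) g G(1)] F(2) G(2)
      by simp
  qed
qed

text \<open>The square defining the arrow part is the naturality square of
  \<open>\<tau>\<close>.\<close>

lemma dagger_of_param_initial_algebra: "param_initial_algebra A B T (dagger_of A B T ob \<tau>) \<tau>"
  unfolding param_initial_algebra_def natural_iso_def
proof (intro conjI ballI)
  show "is_functor A B (dagger_of A B T ob \<tau>)" by (rule dagger_of_functor)
next
  fix X
  assume X: "X \<in> Obj A"
  show "\<tau> X \<in> hom B (omap (T \<circ>\<^sub>F pair_fun id_fun (dagger_of A B T ob \<tau>)) X)
      (omap (dagger_of A B T ob \<tau>) X)"
    using struct_hom[OF X] by (simp add: pair_fun_def id_fun_def dagger_of_def)
  show "is_iso B (\<tau> X)" by (rule lambek_initial_algebra_iso[OF B fix_param_functor[OF X] ini[OF X]])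
  show "is_initial_algebra B (fix_param A T X) (omap (dagger_of A B T ob \<tau>) X) (\<tau> X)"
    using ini[OF X] by (simp add: dagger_of_def)
next
  fix f
  assume "f \<in> Arr A"
  from dagger_of_map(2)[OF arr_in_hom[OF this]]
  show "Comp B (\<tau> (Cod A f)) (amap (T \<circ>\<^sub>F pair_fun id_fun (dagger_of A B T ob \<tau>)) f) =
      Comp B (amap (dagger_of A B T ob \<tau>) f) (\<tau> (Dom A f))"
    by (simp add: pair_fun_def id_fun_def)
qed

end

text \<open>Naturality of \<open>\<tau>\<close> is the square with a unique solution in
  \<open>param_map_ex1\<close>. So even for an arbitrary parameterised initial algebra, the arrow
  part is determined by carriers and structure maps.\<close>

lemma param_initial_algebra_map_eqI:
  assumes P: "param_initial_algebra A B T Td \<tau>" and f: "f \<in> hom A X Y"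
    and h: "h \<in> hom B (omap Td X) (omap Td Y)" "Comp B h (\<tau> X) = Comp B (\<tau> Y) (amap T (f, h))"
  shows "amap Td f = h"
proof -
  from P have ini: "\<And>X. X \<in> Obj A \<Longrightarrow> is_initial_algebra B (fix_param A T X) (omap Td X) (\<tau> X)"
    and D: "is_functor A B Td" and N: "natural_iso A B (T \<circ>\<^sub>F pair_fun id_fun Td) Td \<tau>"
    by (auto simp: param_initial_algebra_def)
  have "Comp B (amap Td f) (\<tau> X) = Comp B (\<tau> Y) (amap T (f, amap Td f))"
    using N homD[OF f] by (auto simp: natural_iso_def pair_fun_def id_fun_def)
  then show ?thesis
    using param_map_ex1[OF ini f] functor_hom[OF D f] h by blast
qed

lemma dagger_param_initial_algebra:
  assumes c: "is_choice B c"
    and cc: "\<And>X. X \<in> Obj A \<Longrightarrow> omega_cocontinuous B B (fix_param A T X)"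
  shows "param_initial_algebra A B T (dagger A B c T) (dagger_iso A B c T)"
  unfolding dagger_eq_dagger_of
  using adamek_init_alg_initial[OF B c fix_param_functor cc]
  by (intro dagger_of_param_initial_algebra) (simp add: dagger_iso_def)

end

section \<open>Slices\<close>

lemma slice_obj: "X \<in> Obj (slice C I) \<longleftrightarrow> fst X \<in> Obj C \<and> snd X \<in> hom C (fst X) I"
  by (auto simp: slice_def)

lemma slice_hom:
  "u \<in> hom (slice C I) X Y \<longleftrightarrow> X \<in> Obj (slice C I) \<and> Y \<in> Obj (slice C I) \<and>
     (\<exists>f. u = (X, f, Y) \<and> f \<in> hom C (fst X) (fst Y) \<and> Comp C (snd Y) f = snd X)"
  by (cases X; cases Y) (auto simp: hom_def slice_def)

lemma slice_homI:
  "X \<in> Obj (slice C I) \<Longrightarrow> Y \<in> Obj (slice C I) \<Longrightarrow> f \<in> hom C (fst X) (fst Y) \<Longrightarrow>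
    Comp C (snd Y) f = snd X \<Longrightarrow> (X, f, Y) \<in> hom (slice C I) X Y"
  by (simp add: slice_hom)

lemma slice_forget_simps [simp]:
  "omap slice_forget X = fst X" "amap slice_forget u = fst (snd u)"
  by (simp_all add: slice_forget_def split: prod.splits)

lemma slice_forget_hom:
  assumes "u \<in> hom (slice C I) X Y"
  shows "u = (X, fst (snd u), Y)" "fst (snd u) \<in> hom C (fst X) (fst Y)"
    "Comp C (snd Y) (fst (snd u)) = snd X" "X \<in> Obj (slice C I)" "Y \<in> Obj (slice C I)"
  using assms by (auto simp: slice_hom)

lemma slice_simps [simp]:
  "Ident (slice C I) X = (X, Ident C (fst X), X)"
  "Comp (slice C I) v u = (fst u, Comp C (fst (snd v)) (fst (snd u)), snd (snd v))"
  by (auto simp: slice_def split: prod.splits)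

text \<open>Faithfulness of \<open>slice_forget\<close>: uniqueness in the slice reduces to
  uniqueness in \<open>C\<close>.\<close>

lemma slice_hom_eqI:
  "u \<in> hom (slice C I) X Y \<Longrightarrow> v \<in> hom (slice C I) X Y \<Longrightarrow> fst (snd u) = fst (snd v) \<Longrightarrow> u = v"
  by (auto simp: slice_hom)

lemma category_slice:
  assumes C: "category C"
  shows "category (slice C I)"
proof -
  let ?S = "slice C I"
  have id: "Ident ?S X \<in> hom ?S X X" if "X \<in> Obj ?S" for X
    using that comp_ident[OF C] ident_in_hom[OF C] by (auto simp: slice_hom slice_obj)
  have co: "Comp ?S v u \<in> hom ?S X Z" if u: "u \<in> hom ?S X Y" and v: "v \<in> hom ?S Y Z" for u v X Y Z
  proof -
    note U = slice_forget_hom[OF u] and V = slice_forget_hom[OF v]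
    have "snd Z \<in> hom C (fst Z) I" using V(5) by (simp add: slice_obj)
    from comp_assoc[OF C U(2) V(2) this] comp_in_hom[OF C U(2) V(2)] U(3-5) V(3-5)
    show ?thesis by (subst U(1), subst V(1)) (simp add: slice_hom)
  qed
  show ?thesis
    unfolding category_def
  proof (intro conjI ballI impI)
    fix u
    assume "u \<in> Arr ?S"
    note u = arr_in_hom[OF this]
    note U = slice_forget_hom[OF u]
    show "Dom ?S u \<in> Obj ?S" "Cod ?S u \<in> Obj ?S" by (fact U)+
    show "Comp ?S u (Ident ?S (Dom ?S u)) = u" "Comp ?S (Ident ?S (Cod ?S u)) u = u"
      using comp_ident[OF C U(2)] U(1) by (auto simp: prod_eq_iff)
    fix v
    assume "v \<in> Arr ?S" and uv: "Cod ?S u = Dom ?S v"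
    note v = arr_in_hom[OF this(1)]
    show "Comp ?S v u \<in> hom ?S (Dom ?S u) (Cod ?S v)"
      using co[OF u v[folded uv]] .
    fix w
    assume "w \<in> Arr ?S" and vw: "Cod ?S v = Dom ?S w"
    note w = arr_in_hom[OF this(1)]
    note V = slice_forget_hom[OF v[folded uv]] and W = slice_forget_hom[OF w[folded vw]]
    show "Comp ?S w (Comp ?S v u) = Comp ?S (Comp ?S w v) u"
      using comp_assoc[OF C U(2) V(2) W(2)] by simp
  qed (fact id)
qed

lemma slice_forget_functor:
  assumes C: "category C"
  shows "is_functor (slice C I) C slice_forget"
  by (rule functorI[OF category_slice[OF C]]) (auto simp: slice_obj dest: slice_forget_hom)

lemma slice_cocone:
  assumes co: "is_cocone omega (slice C I) D Y \<mu>"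
  shows "is_cocone omega C (slice_forget \<circ>\<^sub>F D) (fst Y) (\<lambda>i. fst (snd (\<mu> i)))"
proof -
  have Y: "Y \<in> Obj (slice C I)" and m: "\<And>i. \<mu> i \<in> hom (slice C I) (omap D i) Y"
    and e: "\<And>i j. i \<le> j \<Longrightarrow> Comp (slice C I) (\<mu> j) (amap D (i, j)) = \<mu> i"
    using co by (simp_all add: omega_cocone_iff del: slice_simps)
  have "Comp C (fst (snd (\<mu> j))) (fst (snd (amap D (i, j)))) = fst (snd (\<mu> i))" if "i \<le> j" for i j
    using arg_cong[OF e[OF that], of "\<lambda>u. fst (snd u)"] by simp
  then show ?thesis
    using Y slice_forget_hom(2)[OF m] by (simp add: omega_cocone_iff slice_obj)
qed

context
  fixes C :: "('o, 'm) cat" and I :: 'o and c :: "('o, 'm) choice"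
  assumes C: "category C" and I: "I \<in> Obj C" and c: "is_choice C c"
begin

text \<open>Triangles over \<open>I\<close> starting at the initial object of \<open>C\<close>
  commute automatically, so initiality lifts.\<close>

lemma slice_choice_initial: "is_initial (slice C I) (ch_initial (slice_choice C I c))"
proof -
  note Z = choiceD(1)[OF c]
  obtain d where d: "d \<in> hom C (ch_initial c) I" using initialD(2)[OF Z I] by blast
  then have "(THE d. d \<in> hom C (ch_initial c) I) = d"
    using initialD(3)[OF Z _ _ C] by (blast intro: the_equality)
  then have eq: "ch_initial (slice_choice C I c) = (ch_initial c, d)"
    by (simp add: slice_choice_def Let_def)
  have Zd: "(ch_initial c, d) \<in> Obj (slice C I)" using d initialD(1)[OF Z] by (simp add: slice_obj)
  show ?thesis
    unfolding eq is_initial_def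
  proof (intro conjI ballI)
    fix Y
    assume Y: "Y \<in> Obj (slice C I)"
    then have Y': "fst Y \<in> Obj C" "snd Y \<in> hom C (fst Y) I" by (auto simp: slice_obj)
    obtain f where f: "f \<in> hom C (ch_initial c) (fst Y)" using initialD(2)[OF Z Y'(1)] by blast
    have "Comp C (snd Y) f = d"
      using initialD(3)[OF Z comp_in_hom[OF C f Y'(2)] d C] .
    then have "((ch_initial c, d), f, Y) \<in> hom (slice C I) (ch_initial c, d) Y"
      using Zd Y f by (simp add: slice_hom)
    then show "\<exists>!u. u \<in> hom (slice C I) (ch_initial c, d) Y"
      using initialD(3)[OF Z _ _ C] by (auto simp: slice_hom)
  qed (fact Zd)
qed

text \<open>The triangles over \<open>I\<close> of the arrows of \<open>D\<close> say exactly that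
  the structure maps form a cocone with vertex \<open>I\<close> on the underlying chain. Its
  mediating map is the structure map \<open>d\<close> of the colimit, so the description in
  \<open>slice_choice\<close> is meaningful.\<close>

lemma slice_choice_colimit:
  assumes D: "is_functor omega (slice C I) D"
  shows "is_colimit omega (slice C I) D (ch_colim (slice_choice C I c) D) (ch_leg (slice_choice C I c) D)"
proof -
  let ?S = "slice C I" and ?UD = "slice_forget \<circ>\<^sub>F D"
  let ?X = "ch_colim c ?UD" and ?\<kappa> = "ch_leg c ?UD"
  note UD = is_functor_comp[OF D slice_forget_functor[OF C]]
  note col = choiceD(2)[OF c UD]
  note K = omega_colimitD[OF col]
  have Dobj: "omap D i \<in> Obj ?S" for i using functor_obj[OF D, of i] by simp
  have Dhom: "amap D (i, j) \<in> hom ?S (omap D i) (omap D j)" if "i \<le> j" for i j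
    using functor_hom[OF D, of "(i, j)" i j] that by (simp add: hom_def)
  have "is_cocone omega C ?UD I (\<lambda>i. snd (omap D i))"
    using I Dobj slice_forget_hom(3)[OF Dhom] by (auto simp: omega_cocone_iff slice_obj)
  from K(4)[OF this] have ex1: "\<exists>!d. d \<in> hom C ?X I \<and> (\<forall>i. Comp C d (?\<kappa> i) = snd (omap D i))" .
  define d where "d = (THE d. d \<in> hom C ?X I \<and> (\<forall>i. Comp C d (?\<kappa> i) = snd (omap D i)))"
  have d: "d \<in> hom C ?X I" "\<And>i. Comp C d (?\<kappa> i) = snd (omap D i)"
    using theI'[OF ex1] unfolding d_def by auto
  have eq: "ch_colim (slice_choice C I c) D = (?X, d)"
    "ch_leg (slice_choice C I c) D = (\<lambda>i. (omap D i, ?\<kappa> i, (?X, d)))"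
    by (simp_all add: slice_choice_def Let_def d_def)
  have Xd: "(?X, d) \<in> Obj ?S" using d K(1) by (simp add: slice_obj)
  have k: "(omap D i, ?\<kappa> i, (?X, d)) \<in> hom ?S (omap D i) (?X, d)" for i
    using Dobj Xd K(2)[of i] d by (simp add: slice_hom)
  show ?thesis
    unfolding eq is_colimit_def
  proof (intro conjI allI impI)
    show "is_cocone omega ?S D (?X, d) (\<lambda>i. (omap D i, ?\<kappa> i, (?X, d)))"
      unfolding omega_cocone_iff
    proof (intro conjI allI impI)
      fix i j :: nat
      assume ij: "i \<le> j"
      show "Comp ?S (omap D j, ?\<kappa> j, (?X, d)) (amap D (i, j)) = (omap D i, ?\<kappa> i, (?X, d))"
        using K(3)[OF ij] arg_cong[OF slice_forget_hom(1)[OF Dhom[OF ij]], of fst] by simp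
    qed (fact Xd k)+
  next
    fix Y \<mu>
    assume co: "is_cocone omega ?S D Y \<mu>"
    then have m: "\<mu> i \<in> hom ?S (omap D i) Y" for i by (simp add: omega_cocone_iff)
    note M = slice_forget_hom[OF m]
    have Y: "Y \<in> Obj ?S" "snd Y \<in> hom C (fst Y) I" using M(5) by (auto simp: slice_obj)
    note ex = K(4)[OF slice_cocone[OF co]]
    then obtain h where h: "h \<in> hom C ?X (fst Y)" "\<And>i. Comp C h (?\<kappa> i) = fst (snd (\<mu> i))" by blast
    \<comment> \<open>The mediating map of \<open>C\<close> is a slice morphism: on each leg both
      sides give the structure map of \<open>omap D i\<close>.\<close>
    have "Comp C (snd Y) h = d"
    proof (rule colimit_hom_eqI[OF C UD col comp_in_hom[OF C h(1) Y(2)] d(1)])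
      fix i
      show "Comp C (Comp C (snd Y) h) (?\<kappa> i) = Comp C d (?\<kappa> i)"
        using comp_assoc[OF C K(2) h(1) Y(2)] h(2) d(2) M(3) by simp
    qed
    then have H: "((?X, d), h, Y) \<in> hom ?S (?X, d) Y"
      using Xd Y h by (simp add: slice_hom)
    show "\<exists>!u. u \<in> hom ?S (?X, d) Y \<and>
        (\<forall>i\<in>Obj omega. Comp ?S u (omap D i, ?\<kappa> i, (?X, d)) = \<mu> i)"
    proof (intro ex1I conjI ballI)
      fix i
      show "Comp ?S ((?X, d), h, Y) (omap D i, ?\<kappa> i, (?X, d)) = \<mu> i"
        using h(2) M(1)[of i] by (simp add: prod_eq_iff)
    next
      fix u
      assume u: "u \<in> hom ?S (?X, d) Y \<and>
        (\<forall>i\<in>Obj omega. Comp ?S u (omap D i, ?\<kappa> i, (?X, d)) = \<mu> i)"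
      then have "Comp ?S u (omap D i, ?\<kappa> i, (?X, d)) = \<mu> i" for i
        by (simp del: slice_simps)
      then have uk: "Comp C (fst (snd u)) (?\<kappa> i) = fst (snd (\<mu> i))" for i
        by (metis slice_simps(2) fst_conv snd_conv)
      have "fst (snd u) \<in> hom C ?X (fst Y)"
        using slice_forget_hom(2) u by fastforce
      then have "fst (snd u) = h"
        using colimit_hom_eqI[OF C UD col _ h(1)] uk h(2) by simp
      then show "u = ((?X, d), h, Y)"
        using slice_hom_eqI[OF _ H] u by simp
    qed (fact H)
  qed
qed

lemma slice_choice_is_choice: "is_choice (slice C I) (slice_choice C I c)"
  by (simp add: is_choice_def slice_choice_initial slice_choice_colimit)

end

text \<open>The underlying object and legs of a chosen slice colimit depend on \<open>D\<close> only
  through its underlying chain, so equality of underlying chains gives equality, not just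
  isomorphism, of underlying colimits.\<close>

lemma slice_choice_simps:
  "fst (ch_initial (slice_choice C I c)) = ch_initial c"
  "fst (ch_colim (slice_choice C I c) D) = ch_colim c (slice_forget \<circ>\<^sub>F D)"
  "fst (snd (ch_leg (slice_choice C I c) D i)) = ch_leg c (slice_forget \<circ>\<^sub>F D) i"
  by (simp_all add: slice_choice_def Let_def)

section \<open>Initial algebras over the forgetful functor\<close>

context
  fixes C :: "('o, 'm) cat" and I :: 'o
    and F :: "('o \<times> 'm, ('o \<times> 'm) \<times> 'm \<times> ('o \<times> 'm), 'o \<times> 'm, ('o \<times> 'm) \<times> 'm \<times> ('o \<times> 'm)) functr"
    and G :: "('o, 'm, 'o, 'm) functr"
  assumes C: "category C"
    and F: "is_functor (slice C I) (slice C I) F" and G: "is_functor C C G"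
    and over: "functor_eq (slice C I) (G \<circ>\<^sub>F slice_forget) (slice_forget \<circ>\<^sub>F F)"
begin

lemma over_obj: "X \<in> Obj (slice C I) \<Longrightarrow> omap G (fst X) = fst (omap F X)"
  using over by (simp add: functor_eq_def)

lemma over_hom: "u \<in> hom (slice C I) X Y \<Longrightarrow> amap G (fst (snd u)) = fst (snd (amap F u))"
  using over by (simp add: functor_eq_def hom_def)

text \<open>The isomorphism between the two initial algebras of \<open>C\<close> becomes one of the
  slice once \<open>Y\<close> gets the structure map that makes \<open>j\<close> a morphism over
  \<open>I\<close>. Transport along it has \<open>b\<close> as its underlying map because
  \<open>i\<close> is an algebra morphism with inverse \<open>j\<close>.\<close>

lemma lift_initial_algebra:
  assumes X: "is_initial_algebra (slice C I) F X a"
    and UX: "is_initial_algebra C G (fst X) (fst (snd a))" and Y: "is_initial_algebra C G Y b"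
  obtains d b' where "is_initial_algebra (slice C I) F (Y, d) b'" "fst (snd b') = b"
proof -
  note S = category_slice[OF C, of I]
  obtain i j where i: "i \<in> hom C (fst X) Y" and j: "j \<in> hom C Y (fst X)"
    and ij: "Comp C i j = Ident C Y" and ji: "Comp C j i = Ident C (fst X)"
    and ia: "Comp C i (fst (snd a)) = Comp C b (amap G i)"
    using initial_algebra_unique_iso[OF C G UX Y] .
  note a = initial_algebraD(2)[OF UX] and b = initial_algebraD(2)[OF Y]
  have Xo: "X \<in> Obj (slice C I)" by (rule initial_algebraD(1)[OF X])
  then have sX: "snd X \<in> hom C (fst X) I" by (simp add: slice_obj)
  define d where "d = Comp C (snd X) j"
  have Yd: "(Y, d) \<in> Obj (slice C I)"
    using comp_in_hom[OF C j sX] hom_obj(1)[OF C j] by (simp add: slice_obj d_def)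
  have "Comp C d i = snd X"
    using comp_assoc[OF C i j sX] ji comp_ident[OF C sX] by (simp add: d_def)
  then have I: "(X, i, (Y, d)) \<in> hom (slice C I) X (Y, d)" using Xo Yd i by (simp add: slice_homI)
  have J: "((Y, d), j, X) \<in> hom (slice C I) (Y, d) X" using Xo Yd j by (simp add: slice_homI d_def)
  let ?b = "Comp (slice C I) (X, i, (Y, d)) (Comp (slice C I) a (amap F ((Y, d), j, X)))"
  have "is_initial_algebra (slice C I) F (Y, d) ?b"
    by (rule initial_algebra_transport[OF S F X I J]) (simp_all add: ij ji)
  moreover have "fst (snd ?b) = b"
  proof -
    note Gi = functor_hom[OF G i] and Gj = functor_hom[OF G j]
    have "fst (snd ?b) = Comp C i (Comp C (fst (snd a)) (amap G j))"
      using over_hom[OF J] by simp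
    also have "\<dots> = Comp C b (Comp C (amap G i) (amap G j))"
      using comp_assoc[OF C Gj a i] comp_assoc[OF C Gj Gi b] ia by simp
    also have "Comp C (amap G i) (amap G j) = Ident C (omap G Y)"
      using functor_comp[OF G j i] functor_ident[OF G hom_obj(1)[OF C j]] ij by simp
    finally show ?thesis using comp_ident[OF C b] by simp
  qed
  ultimately show thesis by (rule that)
qed

context
  fixes c :: "('o, 'm) choice"
  assumes I: "I \<in> Obj C" and c: "is_choice C c"
begin

lemma slice_init_obj: "fst (init_obj (slice_choice C I c) F i) = init_obj c G i"
proof (induction i)
  case 0
  show ?case by (simp add: init_obj_def slice_choice_simps)
next
  case (Suc i)
  have "init_obj (slice_choice C I c) F i \<in> Obj (slice C I)"
    by (rule init_obj_in[OF category_slice[OF C] slice_choice_is_choice[OF C I c] F])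
  from over_obj[OF this] Suc show ?case by (simp add: init_obj_def)
qed

text \<open>At stage 0 both sides are arrows out of the initial object with equal codomains; later
  stages apply \<open>F\<close> and \<open>G\<close>.\<close>

lemma slice_init_step:
  "fst (snd (init_step (slice C I) (slice_choice C I c) F i)) = init_step C c G i"
proof (induction i)
  case 0
  let ?s = "init_step (slice C I) (slice_choice C I c) F 0"
  note s = init_step_0[OF category_slice[OF C] slice_choice_is_choice[OF C I c] F]
  have "omap G (ch_initial c) = fst (omap F (ch_initial (slice_choice C I c)))"
    using over_obj[OF slice_forget_hom(4)[OF s]] by (simp add: slice_choice_simps)
  then show ?case
    using slice_forget_hom(2)[OF s] init_step_0[OF C c G] initialD(3)[OF choiceD(1)[OF c] _ _ C]
    by (simp add: slice_choice_simps)
next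
  case (Suc i)
  have "init_step (slice C I) (slice_choice C I c) F i \<in> hom (slice C I)
      (init_obj (slice_choice C I c) F i) (init_obj (slice_choice C I c) F (Suc i))"
    by (rule init_step_in[OF category_slice[OF C] slice_choice_is_choice[OF C I c] F])
  from over_hom[OF this] Suc show ?case by (simp add: init_step_def)
qed

text \<open>An equality of records, covering also the pairs with j < i, where truncated subtraction
  makes both sides identities. Nothing weaker could be substituted under \<open>ch_colim c\<close>
  and \<open>ch_leg c\<close>.\<close>

lemma slice_init_chain:
  "slice_forget \<circ>\<^sub>F init_chain (slice C I) (slice_choice C I c) F = init_chain C c G"
proof -
  have "fst (snd (chain_arr (slice C I) (slice_choice C I c) F i k)) = chain_arr C c G i k" for i k
    by (induction k) (simp_all add: slice_init_obj slice_init_step)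
  then show ?thesis
    by (auto simp: init_chain_def comp_fun_def slice_init_obj)
qed

lemma slice_init_alg_obj:
  "fst (init_alg_obj (slice C I) (slice_choice C I c) F) = init_alg_obj C c G"
  by (simp add: init_alg_obj_def slice_choice_simps slice_init_chain)

text \<open>Applying \<open>slice_forget\<close> to the equations on the legs gives those that
  determine \<open>init_alg_map C c G\<close>; the uniqueness used is that in
  \<open>C\<close>.\<close>

lemma slice_init_alg_map:
  assumes Fcc: "omega_cocontinuous (slice C I) (slice C I) F" and Gcc: "omega_cocontinuous C C G"
  shows "fst (snd (init_alg_map (slice C I) (slice_choice C I c) F)) = init_alg_map C c G"
proof -
  let ?S = "slice C I" and ?ca = "slice_choice C I c"
  let ?X = "init_alg_obj ?S ?ca F" and ?a = "init_alg_map ?S ?ca F"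
  let ?\<kappa> = "ch_leg ?ca (init_chain ?S ?ca F)"
  note ctx = category_slice[OF C, of I] slice_choice_is_choice[OF C I c] F Fcc
  note a = init_alg_map[OF ctx]
  have k: "?\<kappa> i \<in> hom ?S (init_obj ?ca F i) ?X" for i
    using omega_colimitD(2)[OF init_chain_colimit[OF ctx], of i] by (simp add: init_chain_def)
  have Uk: "fst (snd (?\<kappa> i)) = ch_leg c (init_chain C c G) i" for i
    by (simp add: slice_choice_simps slice_init_chain)
  have "fst (snd ?a) \<in> hom C (omap G (init_alg_obj C c G)) (init_alg_obj C c G)"
    using slice_forget_hom(2)[OF a(1)] over_obj[OF slice_forget_hom(5)[OF a(1)]] slice_init_alg_obj
    by simp
  moreover have "Comp C (fst (snd ?a)) (amap G (ch_leg c (init_chain C c G) i)) =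
      ch_leg c (init_chain C c G) (Suc i)" for i
    using arg_cong[OF a(2)[of i], of "\<lambda>u. fst (snd u)"] over_hom[OF k[of i]] Uk by simp
  ultimately show ?thesis
    using init_alg_map_ex1[OF C c G Gcc] init_alg_map[OF C c G Gcc] by blast
qed

end

end

section \<open>Parameterised initial algebras over the forgetful functor\<close>

context
  fixes A :: "('a, 'b) cat" and A' :: "('p, 'q) cat" and P :: "('p, 'q, 'a, 'b) functr"
    and C :: "('o, 'm) cat" and I :: 'o
    and T :: "('a \<times> 'o, 'b \<times> 'm, 'o, 'm) functr"
    and H :: "('p \<times> 'o \<times> 'm, 'q \<times> ('o \<times> 'm) \<times> 'm \<times> ('o \<times> 'm), 'o \<times> 'm, ('o \<times> 'm) \<times> 'm \<times> ('o \<times> 'm)) functr"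
  assumes A: "category A" and A': "category A'" and C: "category C" and P: "is_functor A' A P"
    and T: "is_functor (prod_cat A C) C T"
    and H: "is_functor (prod_cat A' (slice C I)) (slice C I) H"
    and over_o: "\<And>X Y. X \<in> Obj A' \<Longrightarrow> Y \<in> Obj (slice C I) \<Longrightarrow>
      omap T (omap P X, fst Y) = fst (omap H (X, Y))"
    and over_a: "\<And>f u. f \<in> Arr A' \<Longrightarrow> u \<in> Arr (slice C I) \<Longrightarrow>
      amap T (amap P f, fst (snd u)) = fst (snd (amap H (f, u)))"
begin

text \<open>The fixed parameter enters on arrows as an identity, so preservation of identities by
  \<open>P\<close> is what matches the two sides.\<close>

lemma fix_param_over:
  assumes X: "X \<in> Obj A'"
  shows "functor_eq (slice C I) (fix_param A T (omap P X) \<circ>\<^sub>F slice_forget)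
    (slice_forget \<circ>\<^sub>F fix_param A' H X)"
  using over_o[OF X] over_a[OF homD(1)[OF ident_in_hom[OF A' X]]] functor_ident[OF P X]
  by (simp add: functor_eq_def)

text \<open>The image under \<open>slice_forget\<close> of the naturality square of
  \<open>\<psi>\<close> at \<open>f\<close> is the square that determines
  \<open>amap Td (amap P f)\<close>; hence agreement on carriers and structure maps already gives
  agreement on morphisms.\<close>

lemma param_initial_algebra_over:
  assumes Td: "param_initial_algebra A C T Td \<phi>"
    and Hd: "param_initial_algebra A' (slice C I) H Hd \<psi>"
    and ob: "\<And>X. X \<in> Obj A' \<Longrightarrow> omap Td (omap P X) = fst (omap Hd X)"
    and str: "\<And>X. X \<in> Obj A' \<Longrightarrow> \<phi> (omap P X) = fst (snd (\<psi> X))"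
  shows "functor_eq A' (Td \<circ>\<^sub>F P) (slice_forget \<circ>\<^sub>F Hd)"
  unfolding functor_eq_def
proof (intro conjI ballI)
  fix f
  assume "f \<in> Arr A'"
  then obtain X Y where f: "f \<in> hom A' X Y" by (rule that[OF arr_in_hom])
  note X = hom_obj(1)[OF A' f] and Y = hom_obj(2)[OF A' f]
  have "is_functor A' (slice C I) Hd"
    and nat: "natural_iso A' (slice C I) (H \<circ>\<^sub>F pair_fun id_fun Hd) Hd \<psi>"
    using Hd unfolding param_initial_algebra_def by blast+
  from functor_hom[OF this(1) f] have Hf: "amap Hd f \<in> hom (slice C I) (omap Hd X) (omap Hd Y)" .
  note Uh = slice_forget_hom(2)[OF Hf]
  have "Comp (slice C I) (\<psi> Y) (amap H (f, amap Hd f)) = Comp (slice C I) (amap Hd f) (\<psi> X)"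
    using bspec[OF conjunct2[OF nat[unfolded natural_iso_def]] homD(1)[OF f]]
    by (simp only: homD(2,3)[OF f] comp_fun_simps pair_fun_def id_fun_def functr.simps)
  from arg_cong[OF this, of "\<lambda>u. fst (snd u)"]
  have sq: "Comp C (fst (snd (\<psi> Y))) (fst (snd (amap H (f, amap Hd f)))) =
      Comp C (fst (snd (amap Hd f))) (fst (snd (\<psi> X)))"
    by simp
  have "amap Td (amap P f) = fst (snd (amap Hd f))"
  proof (rule param_initial_algebra_map_eqI[OF A C T Td functor_hom[OF P f]])
    show "fst (snd (amap Hd f)) \<in> hom C (omap Td (omap P X)) (omap Td (omap P Y))"
      using Uh by (simp only: ob[OF X] ob[OF Y])
    show "Comp C (fst (snd (amap Hd f))) (\<phi> (omap P X)) =
        Comp C (\<phi> (omap P Y)) (amap T (amap P f, fst (snd (amap Hd f))))"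
      using sq by (simp only: str[OF X] str[OF Y] over_a[OF homD(1)[OF f] homD(1)[OF Hf]])
  qed
  then show "amap (Td \<circ>\<^sub>F P) f = amap (slice_forget \<circ>\<^sub>F Hd) f" by simp
qed (simp only: comp_fun_simps slice_forget_simps ob)

context
  fixes c :: "('o, 'm) choice"
  assumes I: "I \<in> Obj C" and c: "is_choice C c"
    and Tcc: "\<And>X. X \<in> Obj A \<Longrightarrow> omega_cocontinuous C C (fix_param A T X)"
    and Hcc: "\<And>X. X \<in> Obj A' \<Longrightarrow> omega_cocontinuous (slice C I) (slice C I) (fix_param A' H X)"
begin

lemma dagger_over:
  assumes X: "X \<in> Obj A'"
  shows "omap (dagger A C c T) (omap P X) =
      fst (omap (dagger A' (slice C I) (slice_choice C I c) H) X)"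
    "dagger_iso A C c T (omap P X) = fst (snd (dagger_iso A' (slice C I) (slice_choice C I c) H X))"
proof -
  note PX = functor_obj[OF P X]
  note ctx = C fix_param_functor[OF A' category_slice[OF C] H X] fix_param_functor[OF A C T PX]
    fix_param_over[OF X] I c
  show "omap (dagger A C c T) (omap P X) =
      fst (omap (dagger A' (slice C I) (slice_choice C I c) H) X)"
    using slice_init_alg_obj[OF ctx] by (simp add: dagger_def Let_def)
  show "dagger_iso A C c T (omap P X) =
      fst (snd (dagger_iso A' (slice C I) (slice_choice C I c) H X))"
    using slice_init_alg_map[OF ctx Hcc[OF X] Tcc[OF PX]] by (simp add: dagger_iso_def)
qed

lemma param_initial_algebra_lift:
  assumes Td: "param_initial_algebra A C T Td \<phi>"
  shows "\<exists>Hd \<psi>. param_initial_algebra A' (slice C I) H Hd \<psi> \<and>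
    functor_eq A' (Td \<circ>\<^sub>F P) (slice_forget \<circ>\<^sub>F Hd) \<and>
    (\<forall>X\<in>Obj A'. \<phi> (omap P X) = fst (snd (\<psi> X)))"
proof -
  let ?S = "slice C I" and ?ca = "slice_choice C I c"
  note S = category_slice[OF C, of I]
  have "\<exists>d b. is_initial_algebra ?S (fix_param A' H X) (omap Td (omap P X), d) b \<and>
      fst (snd b) = \<phi> (omap P X)" if X: "X \<in> Obj A'" for X
  proof -
    note PX = functor_obj[OF P X]
    note FX = fix_param_functor[OF A' S H X] and GX = fix_param_functor[OF A C T PX]
    note ctx = C FX GX fix_param_over[OF X]
    \<comment> \<open>The slice algebra built from the auxiliary choice \<open>c\<close> has an
      initial image in \<open>C\<close>, so it can be transported onto the carrier given by
      \<open>Td\<close>.\<close>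
    have "is_initial_algebra C (fix_param A T (omap P X))
        (fst (init_alg_obj ?S ?ca (fix_param A' H X)))
        (fst (snd (init_alg_map ?S ?ca (fix_param A' H X))))"
      using adamek_init_alg_initial[OF C c GX Tcc[OF PX]] slice_init_alg_obj[OF ctx I c]
        slice_init_alg_map[OF ctx I c Hcc[OF X] Tcc[OF PX]] by simp
    moreover have "is_initial_algebra C (fix_param A T (omap P X)) (omap Td (omap P X)) (\<phi> (omap P X))"
      using Td PX by (simp add: param_initial_algebra_def)
    ultimately show ?thesis
      using lift_initial_algebra[OF ctx
          adamek_init_alg_initial[OF S slice_choice_is_choice[OF C I c] FX Hcc[OF X]]] by blast
  qed
  \<comment> \<open>The structure maps are picked independently for each \<open>X\<close>; no
    coherence is required, since \<open>dagger_of\<close> makes any such family functorial.\<close>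
  then obtain d \<psi> where
    ini: "\<And>X. X \<in> Obj A' \<Longrightarrow>
      is_initial_algebra ?S (fix_param A' H X) (omap Td (omap P X), d X) (\<psi> X)"
    and str: "\<And>X. X \<in> Obj A' \<Longrightarrow> fst (snd (\<psi> X)) = \<phi> (omap P X)"
    by metis
  let ?Hd = "dagger_of A' ?S H (\<lambda>X. (omap Td (omap P X), d X)) \<psi>"
  have Hd: "param_initial_algebra A' ?S H ?Hd \<psi>"
    by (rule dagger_of_param_initial_algebra[OF A' S H ini])
  have eq: "functor_eq A' (Td \<circ>\<^sub>F P) (slice_forget \<circ>\<^sub>F ?Hd)"
    by (rule param_initial_algebra_over[OF Td Hd]) (simp_all add: dagger_of_def str)
  show ?thesis
    by (rule exI[of _ ?Hd], rule exI[of _ \<psi>]) (simp add: Hd eq str)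
qed

end

end

section \<open>Powers\<close>

lemma pow_cat_simps [simp]:
  "Xs \<in> Obj (pow_cat C n) \<longleftrightarrow> length Xs = n \<and> set Xs \<subseteq> Obj C"
  "fs \<in> Arr (pow_cat C n) \<longleftrightarrow> length fs = n \<and> set fs \<subseteq> Arr C"
  "Dom (pow_cat C n) = map (Dom C)" "Cod (pow_cat C n) = map (Cod C)"
  "Ident (pow_cat C n) = map (Ident C)" "Comp (pow_cat C n) = map2 (Comp C)"
  by (simp_all add: pow_cat_def)

lemma pow_cat_hom:
  "fs \<in> hom (pow_cat C n) Xs Ys \<longleftrightarrow> length fs = n \<and> length Xs = n \<and> length Ys = n \<and>
     (\<forall>k<n. fs ! k \<in> hom C (Xs ! k) (Ys ! k))"
  by (auto simp: hom_def list_eq_iff_nth_eq all_set_conv_all_nth subset_eq)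

lemma category_pow_cat:
  assumes C: "category C"
  shows "category (pow_cat C n)"
proof -
  let ?P = "pow_cat C n"
  show ?thesis
    unfolding category_def
  proof (intro conjI ballI impI)
    fix fs
    assume "fs \<in> Arr ?P"
    then have fs: "length fs = n" "\<And>k. k < n \<Longrightarrow> fs ! k \<in> hom C (Dom C (fs ! k)) (Cod C (fs ! k))"
      by (auto simp: hom_def)
    show "Dom ?P fs \<in> Obj ?P" "Cod ?P fs \<in> Obj ?P"
      using fs(1) hom_obj[OF C fs(2)] by (auto simp: in_set_conv_nth)
    show "Comp ?P fs (Ident ?P (Dom ?P fs)) = fs" "Comp ?P (Ident ?P (Cod ?P fs)) fs = fs"
      using fs(1) comp_ident[OF C fs(2)] by (auto intro!: nth_equalityI)
    fix gs
    assume "gs \<in> Arr ?P" and "Cod ?P fs = Dom ?P gs"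
    then have gs: "length gs = n" "\<And>k. k < n \<Longrightarrow> gs ! k \<in> hom C (Cod C (fs ! k)) (Cod C (gs ! k))"
      using fs(1) by (auto simp: hom_def list_eq_iff_nth_eq)
    show "Comp ?P gs fs \<in> hom ?P (Dom ?P fs) (Cod ?P gs)"
      using fs(1) gs(1) comp_in_hom[OF C fs(2) gs(2)] by (simp add: pow_cat_hom)
    fix hs
    assume "hs \<in> Arr ?P" and "Cod ?P gs = Dom ?P hs"
    then have hs: "length hs = n" "\<And>k. k < n \<Longrightarrow> hs ! k \<in> hom C (Cod C (gs ! k)) (Cod C (hs ! k))"
      using gs(1) by (auto simp: hom_def list_eq_iff_nth_eq)
    show "Comp ?P hs (Comp ?P gs fs) = Comp ?P (Comp ?P hs gs) fs"
      using fs(1) gs(1) hs(1) comp_assoc[OF C fs(2) gs(2) hs(2)] by (auto intro!: nth_equalityI)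
  next
    fix Xs
    assume "Xs \<in> Obj ?P"
    then show "Ident ?P Xs \<in> hom ?P Xs Xs"
      using ident_in_hom[OF C] by (auto simp: pow_cat_hom subset_eq)
  qed
qed

lemma pow_fun_simps [simp]: "omap (pow_fun F) Xs = map (omap F) Xs" "amap (pow_fun F) fs = map (amap F) fs"
  by (simp_all add: pow_fun_def)

lemma pow_fun_functor:
  assumes C: "category C" and F: "is_functor C D F"
  shows "is_functor (pow_cat C n) (pow_cat D n) (pow_fun F)"
proof (rule functorI[OF category_pow_cat[OF C]])
  fix Xs
  assume "Xs \<in> Obj (pow_cat C n)"
  then show "omap (pow_fun F) Xs \<in> Obj (pow_cat D n)"
    "amap (pow_fun F) (Ident (pow_cat C n) Xs) = Ident (pow_cat D n) (omap (pow_fun F) Xs)"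
    using functor_obj[OF F] functor_ident[OF F] by auto
next
  fix Xs Ys Zs fs gs
  assume fs: "fs \<in> hom (pow_cat C n) Xs Ys"
  then show "amap (pow_fun F) fs \<in> hom (pow_cat D n) (omap (pow_fun F) Xs) (omap (pow_fun F) Ys)"
    using functor_hom[OF F] by (auto simp: pow_cat_hom)
  assume "gs \<in> hom (pow_cat C n) Ys Zs"
  with fs show "amap (pow_fun F) (Comp (pow_cat C n) gs fs) =
      Comp (pow_cat D n) (amap (pow_fun F) gs) (amap (pow_fun F) fs)"
    by (auto simp: pow_cat_hom intro!: nth_equalityI functor_comp[OF F])
qed

lemma pow_cat_Suc_hom:
  "fs \<in> hom (pow_cat C n) Xs Ys \<Longrightarrow> f \<in> hom C X Y \<Longrightarrow>
    fs @ [f] \<in> hom (pow_cat C (Suc n)) (Xs @ [X]) (Ys @ [Y])"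
  by (auto simp: hom_def)

lemma pow_cat_Suc_homE:
  assumes "u \<in> hom (pow_cat C (Suc n)) (Xs @ [X]) (Ys @ [Y])"
  obtains fs f where "u = fs @ [f]" "fs \<in> hom (pow_cat C n) Xs Ys" "f \<in> hom C X Y"
  using assms that by (cases u rule: rev_cases) (auto simp: hom_def)

text \<open>The hom assumptions give \<open>fs\<close> and \<open>gs\<close> the same length, so
  that \<open>map2\<close> pairs the two last entries with each other.\<close>

lemma pow_cat_Suc_comp:
  "fs \<in> hom (pow_cat C n) Xs Ys \<Longrightarrow> gs \<in> hom (pow_cat C n) Ys Zs \<Longrightarrow>
    Comp (pow_cat C (Suc n)) (gs @ [g]) (fs @ [f]) = Comp (pow_cat C n) gs fs @ [Comp C g f]"
  by (auto simp: pow_cat_hom)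

lemma snoc_fun_simps [simp]:
  "omap snoc_fun (Xs, X) = Xs @ [X]" "amap snoc_fun (fs, f) = fs @ [f]"
  by (simp_all add: snoc_fun_def)

lemma category_prod_cat:
  assumes "category A" "category B"
  shows "category (prod_cat A B)"
  using assms unfolding category_def by (auto simp: prod_cat_def hom_def)

lemma snoc_fun_functor:
  assumes C: "category C"
  shows "is_functor (prod_cat (pow_cat C n) C) (pow_cat C (Suc n)) snoc_fun"
proof (rule functorI[OF category_prod_cat[OF category_pow_cat[OF C] C]])
  fix p q r u v
  assume "u \<in> hom (prod_cat (pow_cat C n) C) p q"
  moreover obtain Xs X Ys Y fs f where pq: "p = (Xs, X)" "q = (Ys, Y)" "u = (fs, f)"
    by (cases p; cases q; cases u)
  ultimately have f: "fs \<in> hom (pow_cat C n) Xs Ys" "f \<in> hom C X Y"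
    by (auto simp: prod_cat_hom)
  then show "amap snoc_fun u \<in> hom (pow_cat C (Suc n)) (omap snoc_fun p) (omap snoc_fun q)"
    by (simp add: pq pow_cat_Suc_hom)
  assume "v \<in> hom (prod_cat (pow_cat C n) C) q r"
  moreover obtain Zs Z gs g where r: "r = (Zs, Z)" "v = (gs, g)"
    by (cases r; cases v)
  ultimately have "gs \<in> hom (pow_cat C n) Ys Zs" "g \<in> hom C Y Z"
    by (auto simp: prod_cat_hom pq)
  with f show "amap snoc_fun (Comp (prod_cat (pow_cat C n) C) v u) =
      Comp (pow_cat C (Suc n)) (amap snoc_fun v) (amap snoc_fun u)"
    by (simp add: pq r pow_cat_Suc_comp del: pow_cat_simps)
qed auto

text \<open>Because \<open>\<omega>\<close> is connected, the colimit of a constant chain is its value.\<close>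
lemma snoc_omega_cocontinuous:
  assumes C: "category C" and Xs: "Xs \<in> Obj (pow_cat C n)"
  shows "omega_cocontinuous C (pow_cat C (Suc n)) (fix_param (pow_cat C n) snoc_fun Xs)"
    (is "omega_cocontinuous C ?P ?G")
proof -
  note Pn = category_pow_cat[OF C, of n]
  let ?i = "Ident (pow_cat C n) Xs"
  note i = ident_in_hom[OF Pn Xs]
  have om: "omap ?G Y = Xs @ [Y]" and am: "amap ?G g = ?i @ [g]" for Y g
    by (simp_all del: pow_cat_simps)
  have G: "is_functor C ?P ?G"
  proof (rule functorI[OF C])
    fix X Y Z f g
    assume f: "f \<in> hom C X Y"
    then show "amap ?G f \<in> hom ?P (omap ?G X) (omap ?G Y)"
      unfolding om am by (rule pow_cat_Suc_hom[OF i])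
    show "amap ?G (Comp C g f) = Comp ?P (amap ?G g) (amap ?G f)"
      unfolding am using pow_cat_Suc_comp[OF i i] comp_ident[OF Pn i] by simp
  qed (use Xs in auto)
  show ?thesis
    unfolding omega_cocontinuous_def
  proof (intro conjI allI impI)
    fix D X \<kappa>
    assume D: "is_functor omega C D" and col: "is_colimit omega C D X \<kappa>"
    note K = omega_colimitD[OF col]
    show "is_colimit omega ?P (?G \<circ>\<^sub>F D) (omap ?G X) (\<lambda>i. amap ?G (\<kappa> i))"
      unfolding is_colimit_def
    proof (intro conjI allI impI)
      have "Comp ?P (amap ?G (\<kappa> k)) (amap ?G (amap D (j, k))) = amap ?G (\<kappa> j)" if jk: "j \<le> k" for j k
      proof -
        have d: "amap D (j, k) \<in> hom C (omap D j) (omap D k)"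
          using functor_hom[OF D, of "(j, k)" j k] jk by (simp add: hom_def)
        show ?thesis using functor_comp[OF G d K(2)] K(3)[OF jk] by simp
      qed
      then show "is_cocone omega ?P (?G \<circ>\<^sub>F D) (omap ?G X) (\<lambda>i. amap ?G (\<kappa> i))"
        unfolding omega_cocone_iff comp_fun_simps
        using functor_obj[OF G K(1)] functor_hom[OF G K(2)] by blast
    next
      fix Y \<mu>
      assume co: "is_cocone omega ?P (?G \<circ>\<^sub>F D) Y \<mu>"
      then have "Y \<in> Obj ?P" and \<mu>: "\<And>j. \<mu> j \<in> hom ?P (Xs @ [omap D j]) Y"
        and \<mu>c: "\<And>j k. j \<le> k \<Longrightarrow> Comp ?P (\<mu> k) (?i @ [amap D (j, k)]) = \<mu> j"
        unfolding omega_cocone_iff comp_fun_simps om am by auto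
      then obtain Ys y where Y: "Y = Ys @ [y]" "y \<in> Obj C"
        by (cases Y rule: rev_cases) auto
      have "\<exists>fs f. \<mu> j = fs @ [f] \<and> fs \<in> hom (pow_cat C n) Xs Ys \<and> f \<in> hom C (omap D j) y" for j
        using \<mu>[of j] unfolding Y(1) by (rule pow_cat_Suc_homE) blast
      then obtain \<nu> m where nm: "\<And>j. \<mu> j = \<nu> j @ [m j]"
        and \<nu>: "\<And>j. \<nu> j \<in> hom (pow_cat C n) Xs Ys" and m: "\<And>j. m j \<in> hom C (omap D j) y"
        by metis
      have "\<nu> k @ [Comp C (m k) (amap D (j, k))] = \<nu> j @ [m j]" if "j \<le> k" for j k
        using \<mu>c[OF that] pow_cat_Suc_comp[OF i \<nu>] comp_ident[OF Pn \<nu>] by (simp add: nm del: pow_cat_simps)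
      \<comment> \<open>The chain acts by identities on the first \<open>n\<close> components, so
        comparison with stage 0 makes all heads equal, and the last components form a cocone over
        \<open>D\<close>.\<close>
      then have \<nu>0: "\<nu> k = \<nu> 0" and mc: "j \<le> k \<Longrightarrow> Comp C (m k) (amap D (j, k)) = m j" for j k
        by (metis append1_eq_conv le0)+
      have "is_cocone omega C D y m"
        using Y(2) m mc by (simp add: omega_cocone_iff)
      from K(4)[OF this] obtain h where h: "h \<in> hom C X y" "\<And>j. Comp C h (\<kappa> j) = m j" by blast
      show "\<exists>!u. u \<in> hom ?P (omap ?G X) Y \<and> (\<forall>j\<in>Obj omega. Comp ?P u (amap ?G (\<kappa> j)) = \<mu> j)"
        unfolding om am Y(1)
      proof (intro ex1I conjI ballI)
        show "\<nu> 0 @ [h] \<in> hom ?P (Xs @ [X]) (Ys @ [y])" by (rule pow_cat_Suc_hom[OF \<nu> h(1)])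
        fix j
        show "Comp ?P (\<nu> 0 @ [h]) (?i @ [\<kappa> j]) = \<mu> j"
          using pow_cat_Suc_comp[OF i \<nu>] comp_ident[OF Pn \<nu>] h(2) nm \<nu>0[of j]
          by (simp del: pow_cat_simps)
      next
        fix u
        assume u: "u \<in> hom ?P (Xs @ [X]) (Ys @ [y]) \<and>
          (\<forall>j\<in>Obj omega. Comp ?P u (?i @ [\<kappa> j]) = \<mu> j)"
        then obtain fs f where f: "u = fs @ [f]" "fs \<in> hom (pow_cat C n) Xs Ys" "f \<in> hom C X y"
          using pow_cat_Suc_homE by metis
        have "fs @ [Comp C f (\<kappa> j)] = \<nu> j @ [m j]" for j
          using u pow_cat_Suc_comp[OF i f(2)] comp_ident[OF Pn f(2)]
          by (simp add: f(1) nm del: pow_cat_simps)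
        \<comment> \<open>A single leg already fixes the head, and \<open>omega\<close> has an
          object; the tails are compared on all legs.\<close>
        then have "fs = \<nu> 0" and "Comp C f (\<kappa> j) = Comp C h (\<kappa> j)" for j
          using h(2) by auto
        with colimit_hom_eqI[OF C D col f(3) h(1)] show "u = \<nu> 0 @ [h]" by (simp add: f(1))
      qed
    qed
  qed (fact G)
qed

lemma split_last_simps [simp]:
  "omap (split_last T) (Xs, X) = omap T (Xs @ [X])" "amap (split_last T) (fs, f) = amap T (fs @ [f])"
  by (simp_all add: split_last_def)

lemma split_last_functor:
  assumes "category C" "is_functor (pow_cat C (Suc n)) D T"
  shows "is_functor (prod_cat (pow_cat C n) C) D (split_last T)"
  unfolding split_last_def by (rule is_functor_comp[OF snoc_fun_functor[OF assms(1)] assms(2)])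

text \<open>Fixing the first \<open>n\<close> arguments is precomposition with the functor that
  appends to \<open>Xs\<close>, which preserves colimits of chains.\<close>

lemma split_last_omega_cocontinuous:
  assumes C: "category C" and T: "omega_cocontinuous (pow_cat C (Suc n)) D T"
    and Xs: "Xs \<in> Obj (pow_cat C n)"
  shows "omega_cocontinuous C D (fix_param (pow_cat C n) (split_last T) Xs)"
proof -
  have "fix_param (pow_cat C n) (split_last T) Xs = T \<circ>\<^sub>F fix_param (pow_cat C n) snoc_fun Xs"
    by (simp add: fix_param_def split_last_def comp_fun_def)
  then show ?thesis
    using omega_cocontinuous_comp[OF snoc_omega_cocontinuous[OF C Xs] T] by simp
qed

text \<open>The strict equations may fail for two independently picked pairs. The first half
  therefore computes both from matching choices; in the second, \<open>Td\<close> is arbitrary and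
  \<open>Hd\<close> is found to fit it.\<close>

theorem theorem18:
  fixes C :: "('o, 'm) cat"
    and I :: 'o
    and n :: nat
    and H :: "(('o \<times> 'm) list, (('o \<times> 'm) \<times> 'm \<times> ('o \<times> 'm)) list,
               'o \<times> 'm, ('o \<times> 'm) \<times> 'm \<times> ('o \<times> 'm)) functr"
    and T :: "('o list, 'm list, 'o, 'm) functr"
  assumes "category C"
    and "has_initial C"
    and "has_omega_colimits C"
    and "I \<in> Obj C"
    and "omega_cocontinuous (pow_cat (slice C I) (n + 1)) (slice C I) H"
    and "omega_cocontinuous (pow_cat C (n + 1)) C T"
    and "functor_eq (pow_cat (slice C I) (n + 1))
           (T \<circ>\<^sub>F pow_fun slice_forget) (slice_forget \<circ>\<^sub>F H)"
  shows
    "\<comment> \<open>the parameterised initial algebras constructed from chosen colimits\<close>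
     (\<forall>c. is_choice C c \<longrightarrow>
       (let ca = slice_choice C I c;
            Td = dagger (pow_cat C n) C c (split_last T);
            \<phi> = dagger_iso (pow_cat C n) C c (split_last T);
            Hd = dagger (pow_cat (slice C I) n) (slice C I) ca (split_last H);
            \<psi> = dagger_iso (pow_cat (slice C I) n) (slice C I) ca (split_last H)
        in is_choice (slice C I) ca \<and>
           param_initial_algebra (pow_cat C n) C (split_last T) Td \<phi> \<and>
           param_initial_algebra (pow_cat (slice C I) n) (slice C I) (split_last H) Hd \<psi> \<and>
           functor_eq (pow_cat (slice C I) n) (Td \<circ>\<^sub>F pow_fun slice_forget) (slice_forget \<circ>\<^sub>F Hd) \<and>
           (\<forall>A\<in>Obj (pow_cat (slice C I) n).
              \<phi> (omap (pow_fun slice_forget) A) = amap slice_forget (\<psi> A)))) \<and>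
     \<comment> \<open>an arbitrary parameterised initial algebra of \<open>T\<close>, and one of \<open>H\<close> lying strictly over it\<close>
     (\<forall>Td \<phi>. param_initial_algebra (pow_cat C n) C (split_last T) Td \<phi> \<longrightarrow>
       (\<exists>Hd \<psi>. param_initial_algebra (pow_cat (slice C I) n) (slice C I) (split_last H) Hd \<psi> \<and>
           functor_eq (pow_cat (slice C I) n) (Td \<circ>\<^sub>F pow_fun slice_forget) (slice_forget \<circ>\<^sub>F Hd) \<and>
           (\<forall>A\<in>Obj (pow_cat (slice C I) n).
              \<phi> (omap (pow_fun slice_forget) A) = amap slice_forget (\<psi> A))))"
proof -
  let ?S = "slice C I" and ?U = "pow_fun slice_forget"
  let ?A = "pow_cat C n" and ?A' = "pow_cat ?S n"
  note C = assms(1) and I = assms(4)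
  note S = category_slice[OF C, of I]
  note Hcc = assms(5)[unfolded Suc_eq_plus1[symmetric]]
    and Tcc = assms(6)[unfolded Suc_eq_plus1[symmetric]]
  have H: "is_functor (prod_cat ?A' ?S) ?S (split_last H)"
    using Hcc by (intro split_last_functor[OF S]) (simp add: omega_cocontinuous_def)
  have T: "is_functor (prod_cat ?A C) C (split_last T)"
    using Tcc by (intro split_last_functor[OF C]) (simp add: omega_cocontinuous_def)
  have over_o: "omap (split_last T) (omap ?U Xs, fst Y) = fst (omap (split_last H) (Xs, Y))"
    if "Xs \<in> Obj ?A'" "Y \<in> Obj ?S" for Xs Y
  proof -
    \<comment> \<open>Since \<open>map\<close> distributes over append, the hypothesis on lists of
      length n+1 splits into the parameter part and the last component.\<close>
    have "Xs @ [Y] \<in> Obj (pow_cat ?S (n + 1))" using that by simp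
    then have "omap (T \<circ>\<^sub>F ?U) (Xs @ [Y]) = omap (slice_forget \<circ>\<^sub>F H) (Xs @ [Y])"
      using assms(7) unfolding functor_eq_def by blast
    then show ?thesis by simp
  qed
  have over_a: "amap (split_last T) (amap ?U fs, fst (snd u)) = fst (snd (amap (split_last H) (fs, u)))"
    if "fs \<in> Arr ?A'" "u \<in> Arr ?S" for fs u
  proof -
    have "fs @ [u] \<in> Arr (pow_cat ?S (n + 1))" using that by simp
    then have "amap (T \<circ>\<^sub>F ?U) (fs @ [u]) = amap (slice_forget \<circ>\<^sub>F H) (fs @ [u])"
      using assms(7) unfolding functor_eq_def by blast
    then show ?thesis by simp
  qed
  note A = category_pow_cat[OF C, of n] and A' = category_pow_cat[OF S, of n]
  note U = pow_fun_functor[OF S slice_forget_functor[OF C]]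
  note ctx = A A' C U T H over_o over_a
  note cc = split_last_omega_cocontinuous[OF C Tcc] split_last_omega_cocontinuous[OF S Hcc]
  show ?thesis
  proof (intro conjI allI impI)
    fix c
    assume c: "is_choice C c"
    note ca = slice_choice_is_choice[OF C I c]
    note Td = dagger_param_initial_algebra[OF A C T c cc(1)]
      and Hd = dagger_param_initial_algebra[OF A' S H ca cc(2)]
    note dag = dagger_over[OF ctx I c cc]
    show "let ca = slice_choice C I c;
            Td = dagger ?A C c (split_last T);
            \<phi> = dagger_iso ?A C c (split_last T);
            Hd = dagger ?A' ?S ca (split_last H);
            \<psi> = dagger_iso ?A' ?S ca (split_last H)
        in is_choice ?S ca \<and>
           param_initial_algebra ?A C (split_last T) Td \<phi> \<and>
           param_initial_algebra ?A' ?S (split_last H) Hd \<psi> \<and>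
           functor_eq ?A' (Td \<circ>\<^sub>F ?U) (slice_forget \<circ>\<^sub>F Hd) \<and>
           (\<forall>A\<in>Obj ?A'. \<phi> (omap ?U A) = amap slice_forget (\<psi> A))"
      unfolding Let_def slice_forget_simps
      using ca Td Hd param_initial_algebra_over[OF ctx Td Hd dag] dag(2) by blast
  next
    fix Td \<phi>
    assume Td: "param_initial_algebra ?A C (split_last T) Td \<phi>"
    \<comment> \<open>Auxiliary: \<open>c\<close> does not occur in the goal and only provides
      initial algebras in the slice from which to lift.\<close>
    obtain c where c: "is_choice C c" using is_choice_exists assms(2,3) by blast
    show "\<exists>Hd \<psi>. param_initial_algebra ?A' ?S (split_last H) Hd \<psi> \<and>
           functor_eq ?A' (Td \<circ>\<^sub>F ?U) (slice_forget \<circ>\<^sub>F Hd) \<and>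
           (\<forall>A\<in>Obj ?A'. \<phi> (omap ?U A) = amap slice_forget (\<psi> A))"
      unfolding slice_forget_simps
      by (rule param_initial_algebra_lift[OF ctx I c cc Td])
  qed
qed

end
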